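(* Let $(\mathbb{M},\Delta,\xi)$ be an abstract distribution monad. For any $\mathbb{M}$-Pettis linear space $E\in\mathscr{L}$, the underlying space $GE$ is an $\mathbb{M}$-algebra when equipped with the $\mathbb{M}$-Pettis structure $a_E:MGE\to GE$ of $E$.
   Context: Standing data. $\mathscr{X}=(\mathscr{X},\boxtimes,I)$ is a closed symmetric monoidal category that is finitely well-complete (it has finite limits and intersections, i.e. fibre products, of arbitrary class-indexed families of strong monomorphisms with common codomain); $\underline{\mathscr{X}}$ is $\mathscr{X}$ enriched in itself. $\mathbb{L}=(L,\eta,\mu^{\mathbb{L}})$ is an $\mathscr{X}$-monad on $\underline{\mathscr{X}}$ that is commutative: with $t'_{XY}:LX\boxtimes Y\to L(X\boxtimes Y)$, $t''_{XY}:X\boxtimes LY\to L(X\boxtimes Y)$ the strengths (transposes of $Y\to\underline{\mathscr{X}}(X,X\boxtimes Y)\xrightarrow{L}\underline{\mathscr{X}}(LX,L(X\boxtimes Y))$ and $X\to\underline{\mathscr{X}}(Y,X\boxtimes Y)\xrightarrow{L}\underline{\mathscr{X}}(LY,L(X\boxtimes Y))$), the morphisms $\otimes_{XY}=\mu^{\mathbb{L}}\cdot Lt'_{XY}\cdot t''_{LX,Y}$ and $\mu^{\mathbb{L}}\cdot Lt''_{XY}\cdot t'_{X,LY}$ from $LX\boxtimes LY$ to $L(X\boxtimes Y)$ coincide. It has tensor products of algebras: for all algebras $(X,a),(Y,b)$ the pair $\mu^{\mathbb{L}}\cdot L\otimes_{XY},\ L(a\boxtimes b):(L(LX\boxtimes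 LY),\mu^{\mathbb{L}})\rightrightarrows(L(X\boxtimes Y),\mu^{\mathbb{L}})$ has a coequalizer in $\mathscr{X}^{\mathbb{L}}$. $\mathscr{L}:=\mathscr{X}^{\mathbb{L}}$, with Eilenberg–Moore $\mathscr{X}$-adjunction $F\dashv G:\mathscr{L}\to\underline{\mathscr{X}}$ (unit $\eta$, counit $\varepsilon$). $\mathscr{L}$ is closed symmetric monoidal (tensor product: for algebras $A=(X,a)$, $B=(Y,b)$, $A\otimes B$ is the coequalizer in $\mathscr{X}^{\mathbb{L}}$ of the pair $\mu^{\mathbb{L}}\cdot L\otimes_{XY},\ L(a\boxtimes b):(L(LX\boxtimes LY),\mu^{\mathbb{L}})\rightrightarrows(L(X\boxtimes Y),\mu^{\mathbb{L}})$; unit object $R:=FI$; internal hom $\underline{\mathscr{L}}(A,B)$ with $G\underline{\mathscr{L}}(A,B)=\mathscr{L}(A,B)$, the hom-object of the Eilenberg–Moore $\mathscr{X}$-category). Objects (morphisms) of $\mathscr{X}$ are called spaces (maps); objects (morphisms) of $\mathscr{L}$ are called linear spaces (linear maps). Embeddings in $\mathscr{L}$ are strong monomorphisms. Duality. $E^*:=\underline{\mathscr{L}}(E,R)$; $\mathbb{H}=(H,\mathfrak{d},\mathfrak{k})$ is the double-dualization monad on $\mathscr{L}$ induced by $\underline{\mathscr{L}}(-,R)\dashv\underline{\mathscr{L}}(-,R):\underline{\mathscr{L}}^{\mathrm{op}}\to\underline{\mathscr{L}}$, so $HE=E^{**}$; it is an $\mathscr{L}$-monad and, applying $G$ to hom-objects,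 an $\mathscr{X}$-monad on $\mathscr{L}$. $E$ is (functionally) separated if $\mathfrak{d}_E:E\to E^{**}$ is an embedding. Monad morphisms. For an $\mathscr{X}$-monad $(T,\eta,\mu)$ on $\mathscr{A}$ and an $\mathscr{X}$-monad $(S,\phi,\nu)$ on $\mathscr{B}$, a morphism $(\lambda,Q):\mathbb{T}\to\mathbb{S}$ consists of an $\mathscr{X}$-functor $Q:\mathscr{B}\to\mathscr{A}$ and an $\mathscr{X}$-natural $\lambda:TQ\to QS$ with $\lambda\cdot\eta Q=Q\phi$ and $\lambda\cdot\mu Q=Q\nu\cdot\lambda S\cdot T\lambda$. Abstract distribution monads. The canonical morphism $(\zeta,G):\mathbb{L}\to\mathbb{H}$ is given by $\zeta_E=G\mathfrak{d}_E\cdot G\varepsilon_E:LGE\to GHE$. An abstract distribution monad $(\mathbb{M},\Delta,\xi)$ is an $\mathscr{X}$-monad $\mathbb{M}=(M,\delta,\kappa)$ on $\underline{\mathscr{X}}$ with $\mathscr{X}$-natural $\Delta:L\to M$, $\xi:MG\to GH$ such that $(\Delta,1):\mathbb{L}\to\mathbb{M}$ and $(\xi,G):\mathbb{M}\to\mathbb{H}$ are monad morphisms with $\xi\cdot\Delta G=\zeta$. $E\in\mathscr{L}$ is $\mathbb{M}$-Pettis if $E$ is separated and there exists a (necessarily unique) map $a_E:MGE\to GE$ in $\mathscr{X}$ with $G\mathfrak{d}_E\cdot a_E=\xi_E$; $a_E$ is then called the $\mathbb{M}$-Pettis structure of $E$. *)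

theory Defs
  imports Main
begin

section \<open>Categories\<close>

record ('o, 'a) category =
  Obj :: "'o set"
  Arr :: "'a set"
  Dom :: "'a \<Rightarrow> 'o"
  Cod :: "'a \<Rightarrow> 'o"
  Id :: "'o \<Rightarrow> 'a"
  Comp :: "'a \<Rightarrow> 'a \<Rightarrow> 'a" (infixr "\<cdot>\<index>" 65)

definition Hom :: "('o, 'a, 'r) category_scheme \<Rightarrow> 'o \<Rightarrow> 'o \<Rightarrow> 'a set" where
  "Hom C A B = {f \<in> Arr C. Dom C f = A \<and> Cod C f = B}"

locale category =
  fixes C :: "('o, 'a, 'r) category_scheme" (structure)
  assumes dom_obj: "f \<in> Arr C \<Longrightarrow> Dom C f \<in> Obj C"
    and cod_obj: "f \<in> Arr C \<Longrightarrow> Cod C f \<in> Obj C"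
    and id_hom: "A \<in> Obj C \<Longrightarrow> Id C A \<in> Hom C A A"
    and comp_hom: "\<lbrakk>g \<in> Hom C B D; f \<in> Hom C A B\<rbrakk> \<Longrightarrow> g \<cdot> f \<in> Hom C A D"
    and comp_id_left: "f \<in> Hom C A B \<Longrightarrow> Id C B \<cdot> f = f"
    and comp_id_right: "f \<in> Hom C A B \<Longrightarrow> f \<cdot> Id C A = f"
    and comp_assoc:
      "\<lbrakk>k \<in> Hom C D E; g \<in> Hom C B D; f \<in> Hom C A B\<rbrakk> \<Longrightarrow> (k \<cdot> g) \<cdot> f = k \<cdot> (g \<cdot> f)"

definition monic :: "('o, 'a, 'r) category_scheme \<Rightarrow> 'a \<Rightarrow> bool" where
  "monic C m \<longleftrightarrow> m \<in> Arr C \<and>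
     (\<forall>A. \<forall>f \<in> Hom C A (Dom C m). \<forall>g \<in> Hom C A (Dom C m).
        m \<cdot>\<^bsub>C\<^esub> f = m \<cdot>\<^bsub>C\<^esub> g \<longrightarrow> f = g)"

definition epic :: "('o, 'a, 'r) category_scheme \<Rightarrow> 'a \<Rightarrow> bool" where
  "epic C e \<longleftrightarrow> e \<in> Arr C \<and>
     (\<forall>B. \<forall>f \<in> Hom C (Cod C e) B. \<forall>g \<in> Hom C (Cod C e) B.
        f \<cdot>\<^bsub>C\<^esub> e = g \<cdot>\<^bsub>C\<^esub> e \<longrightarrow> f = g)"

definition strong_mono :: "('o, 'a, 'r) category_scheme \<Rightarrow> 'a \<Rightarrow> bool" where
  "strong_mono C m \<longleftrightarrow> monic C m \<and>
     (\<forall>e. epic C e \<longrightarrow>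
       (\<forall>f \<in> Hom C (Dom C e) (Dom C m). \<forall>g \<in> Hom C (Cod C e) (Cod C m).
          m \<cdot>\<^bsub>C\<^esub> f = g \<cdot>\<^bsub>C\<^esub> e \<longrightarrow>
            (\<exists>d \<in> Hom C (Cod C e) (Dom C m).
               d \<cdot>\<^bsub>C\<^esub> e = f \<and> m \<cdot>\<^bsub>C\<^esub> d = g)))"

definition invertible :: "('o, 'a, 'r) category_scheme \<Rightarrow> 'a \<Rightarrow> bool" where
  "invertible C f \<longleftrightarrow> f \<in> Arr C \<and>
     (\<exists>g \<in> Hom C (Cod C f) (Dom C f).
        g \<cdot>\<^bsub>C\<^esub> f = Id C (Dom C f) \<and> f \<cdot>\<^bsub>C\<^esub> g = Id C (Cod C f))"

definition inverse_arr :: "('o, 'a, 'r) category_scheme \<Rightarrow> 'a \<Rightarrow> 'a" where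
  "inverse_arr C f = (THE g. g \<in> Hom C (Cod C f) (Dom C f) \<and>
     g \<cdot>\<^bsub>C\<^esub> f = Id C (Dom C f) \<and> f \<cdot>\<^bsub>C\<^esub> g = Id C (Cod C f))"

definition is_equalizer :: "('o, 'a, 'r) category_scheme \<Rightarrow> 'a \<Rightarrow> 'a \<Rightarrow> 'a \<Rightarrow> bool" where
  "is_equalizer C f g e \<longleftrightarrow>
     f \<in> Arr C \<and> g \<in> Hom C (Dom C f) (Cod C f) \<and>
     e \<in> Arr C \<and> Cod C e = Dom C f \<and> f \<cdot>\<^bsub>C\<^esub> e = g \<cdot>\<^bsub>C\<^esub> e \<and>
     (\<forall>A. \<forall>k \<in> Hom C A (Dom C f). f \<cdot>\<^bsub>C\<^esub> k = g \<cdot>\<^bsub>C\<^esub> k \<longrightarrow>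
        (\<exists>!l. l \<in> Hom C A (Dom C e) \<and> e \<cdot>\<^bsub>C\<^esub> l = k))"

definition is_coequalizer :: "('o, 'a, 'r) category_scheme \<Rightarrow> 'a \<Rightarrow> 'a \<Rightarrow> 'a \<Rightarrow> bool" where
  "is_coequalizer C f g e \<longleftrightarrow>
     f \<in> Arr C \<and> g \<in> Hom C (Dom C f) (Cod C f) \<and>
     e \<in> Arr C \<and> Dom C e = Cod C f \<and> e \<cdot>\<^bsub>C\<^esub> f = e \<cdot>\<^bsub>C\<^esub> g \<and>
     (\<forall>B. \<forall>k \<in> Hom C (Cod C f) B. k \<cdot>\<^bsub>C\<^esub> f = k \<cdot>\<^bsub>C\<^esub> g \<longrightarrow>
        (\<exists>!l. l \<in> Hom C (Cod C e) B \<and> l \<cdot>\<^bsub>C\<^esub> e = k))"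

definition is_functor ::
  "('o, 'a, 'r) category_scheme \<Rightarrow> ('p, 'b, 's) category_scheme \<Rightarrow>
     ('o \<Rightarrow> 'p) \<Rightarrow> ('a \<Rightarrow> 'b) \<Rightarrow> bool" where
  "is_functor C D Fo Fa \<longleftrightarrow>
     (\<forall>A \<in> Obj C. Fo A \<in> Obj D \<and> Fa (Id C A) = Id D (Fo A)) \<and>
     (\<forall>f \<in> Arr C. Fa f \<in> Hom D (Fo (Dom C f)) (Fo (Cod C f))) \<and>
     (\<forall>f \<in> Arr C. \<forall>g \<in> Arr C. Dom C g = Cod C f \<longrightarrow>
        Fa (g \<cdot>\<^bsub>C\<^esub> f) = Fa g \<cdot>\<^bsub>D\<^esub> Fa f)"

definition is_cone ::
  "('j, 'b, 's) category_scheme \<Rightarrow> ('o, 'a, 'r) category_scheme \<Rightarrow> ('j \<Rightarrow> 'o) \<Rightarrow> ('b \<Rightarrow> 'a)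
     \<Rightarrow> 'o \<Rightarrow> ('j \<Rightarrow> 'a) \<Rightarrow> bool" where
  "is_cone J C Do Da P p \<longleftrightarrow> P \<in> Obj C \<and>
     (\<forall>j \<in> Obj J. p j \<in> Hom C P (Do j)) \<and>
     (\<forall>u \<in> Arr J. Da u \<cdot>\<^bsub>C\<^esub> p (Dom J u) = p (Cod J u))"

definition is_limit ::
  "('j, 'b, 's) category_scheme \<Rightarrow> ('o, 'a, 'r) category_scheme \<Rightarrow> ('j \<Rightarrow> 'o) \<Rightarrow> ('b \<Rightarrow> 'a)
     \<Rightarrow> 'o \<Rightarrow> ('j \<Rightarrow> 'a) \<Rightarrow> bool" where
  "is_limit J C Do Da P p \<longleftrightarrow> is_cone J C Do Da P p \<and>
     (\<forall>Q q. is_cone J C Do Da Q q \<longrightarrow>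
        (\<exists>!k. k \<in> Hom C Q P \<and> (\<forall>j \<in> Obj J. p j \<cdot>\<^bsub>C\<^esub> k = q j)))"

text \<open>Every finite category is isomorphic to one whose objects and arrows are natural numbers.\<close>

definition has_finite_limits :: "('o, 'a, 'r) category_scheme \<Rightarrow> bool" where
  "has_finite_limits C \<longleftrightarrow>
     (\<forall>(J :: (nat, nat) category) Do Da.
        category J \<and> finite (Obj J) \<and> finite (Arr J) \<and> is_functor J C Do Da \<longrightarrow>
          (\<exists>P p. is_limit J C Do Da P p))"

text \<open>The fibre product of a family of arrows with common codomain \<open>B\<close>: the diagonal is
  \<open>d\<close>, the projections are \<open>p\<close>.  A family is given by the set \<open>S\<close> of its members, since
  repeating a monomorphism does not change the fibre product; for the same reason there
  is no restriction on the size of the index class.\<close>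

definition is_fibre_cone ::
  "('o, 'a, 'r) category_scheme \<Rightarrow> 'o \<Rightarrow> 'a set \<Rightarrow> 'o \<Rightarrow> 'a \<Rightarrow> ('a \<Rightarrow> 'a) \<Rightarrow> bool" where
  "is_fibre_cone C B S P d p \<longleftrightarrow> d \<in> Hom C P B \<and>
     (\<forall>m \<in> S. p m \<in> Hom C P (Dom C m) \<and> m \<cdot>\<^bsub>C\<^esub> p m = d)"

definition is_fibre_product ::
  "('o, 'a, 'r) category_scheme \<Rightarrow> 'o \<Rightarrow> 'a set \<Rightarrow> 'o \<Rightarrow> 'a \<Rightarrow> ('a \<Rightarrow> 'a) \<Rightarrow> bool" where
  "is_fibre_product C B S P d p \<longleftrightarrow> is_fibre_cone C B S P d p \<and>
     (\<forall>Q c q. is_fibre_cone C B S Q c q \<longrightarrow>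
        (\<exists>!k. k \<in> Hom C Q P \<and> d \<cdot>\<^bsub>C\<^esub> k = c \<and>
           (\<forall>m \<in> S. p m \<cdot>\<^bsub>C\<^esub> k = q m)))"

definition finitely_well_complete :: "('o, 'a, 'r) category_scheme \<Rightarrow> bool" where
  "finitely_well_complete C \<longleftrightarrow> has_finite_limits C \<and>
     (\<forall>B \<in> Obj C. \<forall>S. (\<forall>m \<in> S. strong_mono C m \<and> Cod C m = B) \<longrightarrow>
        (\<exists>P d p. is_fibre_product C B S P d p))"


section \<open>Closed symmetric monoidal categories\<close>

record ('o, 'a) smc_category = "('o, 'a) category" +
  tens :: "'o \<Rightarrow> 'o \<Rightarrow> 'o" (infixr "\<boxtimes>\<index>" 70)
  tensa :: "'a \<Rightarrow> 'a \<Rightarrow> 'a" (infixr "\<odot>\<index>" 70)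
  unt :: "'o"
  asc :: "'o \<Rightarrow> 'o \<Rightarrow> 'o \<Rightarrow> 'a"
  lun :: "'o \<Rightarrow> 'a"
  run :: "'o \<Rightarrow> 'a"
  brd :: "'o \<Rightarrow> 'o \<Rightarrow> 'a"
  ihom :: "'o \<Rightarrow> 'o \<Rightarrow> 'o"
  ev :: "'o \<Rightarrow> 'o \<Rightarrow> 'a"

locale smc_category = category V
  for V :: "('o, 'a, 'r) smc_category_scheme" (structure) +
  assumes tens_obj: "\<lbrakk>A \<in> Obj V; B \<in> Obj V\<rbrakk> \<Longrightarrow> A \<boxtimes> B \<in> Obj V"
    and tensa_hom:
      "\<lbrakk>f \<in> Hom V A A'; g \<in> Hom V B B'\<rbrakk> \<Longrightarrow> f \<odot> g \<in> Hom V (A \<boxtimes> B) (A' \<boxtimes> B')"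
    and tensa_id: "\<lbrakk>A \<in> Obj V; B \<in> Obj V\<rbrakk> \<Longrightarrow> Id V A \<odot> Id V B = Id V (A \<boxtimes> B)"
    and tensa_comp:
      "\<lbrakk>f \<in> Hom V A A'; f' \<in> Hom V A' A''; g \<in> Hom V B B'; g' \<in> Hom V B' B''\<rbrakk>
        \<Longrightarrow> (f' \<cdot> f) \<odot> (g' \<cdot> g) = (f' \<odot> g') \<cdot> (f \<odot> g)"
    and unt_obj: "unt V \<in> Obj V"
    and asc_hom: "\<lbrakk>A \<in> Obj V; B \<in> Obj V; D \<in> Obj V\<rbrakk>
        \<Longrightarrow> asc V A B D \<in> Hom V ((A \<boxtimes> B) \<boxtimes> D) (A \<boxtimes> (B \<boxtimes> D))"
    and asc_inv: "\<lbrakk>A \<in> Obj V; B \<in> Obj V; D \<in> Obj V\<rbrakk> \<Longrightarrow> invertible V (asc V A B D)"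
    and asc_nat: "\<lbrakk>f \<in> Hom V A A'; g \<in> Hom V B B'; k \<in> Hom V D D'\<rbrakk>
        \<Longrightarrow> asc V A' B' D' \<cdot> ((f \<odot> g) \<odot> k) = (f \<odot> (g \<odot> k)) \<cdot> asc V A B D"
    and lun_hom: "A \<in> Obj V \<Longrightarrow> lun V A \<in> Hom V (unt V \<boxtimes> A) A"
    and lun_inv: "A \<in> Obj V \<Longrightarrow> invertible V (lun V A)"
    and lun_nat: "f \<in> Hom V A B \<Longrightarrow> lun V B \<cdot> (Id V (unt V) \<odot> f) = f \<cdot> lun V A"
    and run_hom: "A \<in> Obj V \<Longrightarrow> run V A \<in> Hom V (A \<boxtimes> unt V) A"
    and run_inv: "A \<in> Obj V \<Longrightarrow> invertible V (run V A)"
    and run_nat: "f \<in> Hom V A B \<Longrightarrow> run V B \<cdot> (f \<odot> Id V (unt V)) = f \<cdot> run V A"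
    and pentagon: "\<lbrakk>A \<in> Obj V; B \<in> Obj V; D \<in> Obj V; E \<in> Obj V\<rbrakk> \<Longrightarrow>
        asc V A B (D \<boxtimes> E) \<cdot> asc V (A \<boxtimes> B) D E =
        (Id V A \<odot> asc V B D E) \<cdot> asc V A (B \<boxtimes> D) E \<cdot> (asc V A B D \<odot> Id V E)"
    and triangle: "\<lbrakk>A \<in> Obj V; B \<in> Obj V\<rbrakk> \<Longrightarrow>
        (Id V A \<odot> lun V B) \<cdot> asc V A (unt V) B = run V A \<odot> Id V B"
    and brd_hom: "\<lbrakk>A \<in> Obj V; B \<in> Obj V\<rbrakk> \<Longrightarrow> brd V A B \<in> Hom V (A \<boxtimes> B) (B \<boxtimes> A)"
    and brd_nat: "\<lbrakk>f \<in> Hom V A A'; g \<in> Hom V B B'\<rbrakk>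
        \<Longrightarrow> brd V A' B' \<cdot> (f \<odot> g) = (g \<odot> f) \<cdot> brd V A B"
    and brd_brd: "\<lbrakk>A \<in> Obj V; B \<in> Obj V\<rbrakk> \<Longrightarrow> brd V B A \<cdot> brd V A B = Id V (A \<boxtimes> B)"
    and hexagon: "\<lbrakk>A \<in> Obj V; B \<in> Obj V; D \<in> Obj V\<rbrakk> \<Longrightarrow>
        asc V B D A \<cdot> brd V A (B \<boxtimes> D) \<cdot> asc V A B D =
        (Id V B \<odot> brd V A D) \<cdot> asc V B A D \<cdot> (brd V A B \<odot> Id V D)"
    and ihom_obj: "\<lbrakk>A \<in> Obj V; B \<in> Obj V\<rbrakk> \<Longrightarrow> ihom V A B \<in> Obj V"
    and ev_hom: "\<lbrakk>A \<in> Obj V; B \<in> Obj V\<rbrakk> \<Longrightarrow> ev V A B \<in> Hom V (ihom V A B \<boxtimes> A) B"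
    and ev_universal: "\<lbrakk>A \<in> Obj V; B \<in> Obj V; D \<in> Obj V; f \<in> Hom V (D \<boxtimes> A) B\<rbrakk> \<Longrightarrow>
        \<exists>!g. g \<in> Hom V D (ihom V A B) \<and> ev V A B \<cdot> (g \<odot> Id V A) = f"

definition curry_arr ::
  "('o, 'a, 'r) smc_category_scheme \<Rightarrow> 'o \<Rightarrow> 'o \<Rightarrow> 'o \<Rightarrow> 'a \<Rightarrow> 'a" where
  "curry_arr V D A B f = (THE g. g \<in> Hom V D (ihom V A B) \<and>
     ev V A B \<cdot>\<^bsub>V\<^esub> (g \<odot>\<^bsub>V\<^esub> Id V A) = f)"

definition uncurry_arr ::
  "('o, 'a, 'r) smc_category_scheme \<Rightarrow> 'o \<Rightarrow> 'o \<Rightarrow> 'a \<Rightarrow> 'a" where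
  "uncurry_arr V A B g = ev V A B \<cdot>\<^bsub>V\<^esub> (g \<odot>\<^bsub>V\<^esub> Id V A)"

definition precomp :: "('o, 'a, 'r) smc_category_scheme \<Rightarrow> 'a \<Rightarrow> 'o \<Rightarrow> 'a" where
  "precomp V f B = curry_arr V (ihom V (Cod V f) B) (Dom V f) B
     (ev V (Cod V f) B \<cdot>\<^bsub>V\<^esub> (Id V (ihom V (Cod V f) B) \<odot>\<^bsub>V\<^esub> f))"

definition postcomp :: "('o, 'a, 'r) smc_category_scheme \<Rightarrow> 'o \<Rightarrow> 'a \<Rightarrow> 'a" where
  "postcomp V A f = curry_arr V (ihom V A (Dom V f)) A (Cod V f)
     (f \<cdot>\<^bsub>V\<^esub> ev V A (Dom V f))"

definition lax_symmetric_monoidal ::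
  "('o, 'a, 'r) smc_category_scheme \<Rightarrow> ('p, 'b, 's) smc_category_scheme \<Rightarrow>
     ('o \<Rightarrow> 'p) \<Rightarrow> ('a \<Rightarrow> 'b) \<Rightarrow> ('o \<Rightarrow> 'o \<Rightarrow> 'b) \<Rightarrow> 'b \<Rightarrow> bool" where
  "lax_symmetric_monoidal V W Go Ga u u0 \<longleftrightarrow>
     is_functor V W Go Ga \<and>
     (\<forall>A \<in> Obj V. \<forall>B \<in> Obj V. u A B \<in> Hom W (Go A \<boxtimes>\<^bsub>W\<^esub> Go B) (Go (A \<boxtimes>\<^bsub>V\<^esub> B))) \<and>
     u0 \<in> Hom W (unt W) (Go (unt V)) \<and>
     (\<forall>f \<in> Arr V. \<forall>g \<in> Arr V.
        u (Cod V f) (Cod V g) \<cdot>\<^bsub>W\<^esub> (Ga f \<odot>\<^bsub>W\<^esub> Ga g) =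
        Ga (f \<odot>\<^bsub>V\<^esub> g) \<cdot>\<^bsub>W\<^esub> u (Dom V f) (Dom V g)) \<and>
     (\<forall>A \<in> Obj V. \<forall>B \<in> Obj V. \<forall>D \<in> Obj V.
        Ga (asc V A B D) \<cdot>\<^bsub>W\<^esub> u (A \<boxtimes>\<^bsub>V\<^esub> B) D \<cdot>\<^bsub>W\<^esub> (u A B \<odot>\<^bsub>W\<^esub> Id W (Go D)) =
        u A (B \<boxtimes>\<^bsub>V\<^esub> D) \<cdot>\<^bsub>W\<^esub> (Id W (Go A) \<odot>\<^bsub>W\<^esub> u B D) \<cdot>\<^bsub>W\<^esub> asc W (Go A) (Go B) (Go D)) \<and>
     (\<forall>A \<in> Obj V.
        Ga (lun V A) \<cdot>\<^bsub>W\<^esub> u (unt V) A \<cdot>\<^bsub>W\<^esub> (u0 \<odot>\<^bsub>W\<^esub> Id W (Go A)) = lun W (Go A)) \<and>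
     (\<forall>A \<in> Obj V.
        Ga (run V A) \<cdot>\<^bsub>W\<^esub> u A (unt V) \<cdot>\<^bsub>W\<^esub> (Id W (Go A) \<odot>\<^bsub>W\<^esub> u0) = run W (Go A)) \<and>
     (\<forall>A \<in> Obj V. \<forall>B \<in> Obj V.
        Ga (brd V A B) \<cdot>\<^bsub>W\<^esub> u A B = u B A \<cdot>\<^bsub>W\<^esub> brd W (Go A) (Go B))"


section \<open>Enriched categories, functors, transformations and monads\<close>

text \<open>Composition is an arrow \<open>ecomp a b c : A(b,c) \<otimes> A(a,b) \<rightarrow> A(a,c)\<close> and the identity is an
  element \<open>eid a : I \<rightarrow> A(a,a)\<close>.\<close>

record ('x, 'o, 'a) ecategory =
  eobj :: "'x set"
  ehom :: "'x \<Rightarrow> 'x \<Rightarrow> 'o"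
  ecomp :: "'x \<Rightarrow> 'x \<Rightarrow> 'x \<Rightarrow> 'a"
  eid :: "'x \<Rightarrow> 'a"

definition enriched_category ::
  "('o, 'a, 'r) smc_category_scheme \<Rightarrow> ('x, 'o, 'a) ecategory \<Rightarrow> bool" where
  "enriched_category V A \<longleftrightarrow>
     (\<forall>a \<in> eobj A. \<forall>b \<in> eobj A. ehom A a b \<in> Obj V) \<and>
     (\<forall>a \<in> eobj A. \<forall>b \<in> eobj A. \<forall>c \<in> eobj A.
        ecomp A a b c \<in> Hom V (ehom A b c \<boxtimes>\<^bsub>V\<^esub> ehom A a b) (ehom A a c)) \<and>
     (\<forall>a \<in> eobj A. eid A a \<in> Hom V (unt V) (ehom A a a)) \<and>
     (\<forall>a \<in> eobj A. \<forall>b \<in> eobj A. \<forall>c \<in> eobj A. \<forall>d \<in> eobj A.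
        ecomp A a b d \<cdot>\<^bsub>V\<^esub> (ecomp A b c d \<odot>\<^bsub>V\<^esub> Id V (ehom A a b)) =
        ecomp A a c d \<cdot>\<^bsub>V\<^esub> (Id V (ehom A c d) \<odot>\<^bsub>V\<^esub> ecomp A a b c) \<cdot>\<^bsub>V\<^esub>
          asc V (ehom A c d) (ehom A b c) (ehom A a b)) \<and>
     (\<forall>a \<in> eobj A. \<forall>b \<in> eobj A.
        ecomp A a b b \<cdot>\<^bsub>V\<^esub> (eid A b \<odot>\<^bsub>V\<^esub> Id V (ehom A a b)) = lun V (ehom A a b) \<and>
        ecomp A a a b \<cdot>\<^bsub>V\<^esub> (Id V (ehom A a b) \<odot>\<^bsub>V\<^esub> eid A a) = run V (ehom A a b))"

text \<open>Composition in the underlying ordinary category, whose arrows are elements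
  \<open>I \<rightarrow> A(a,b)\<close>.\<close>

definition elcomp ::
  "('o, 'a, 'r) smc_category_scheme \<Rightarrow> ('x, 'o, 'a) ecategory \<Rightarrow> 'x \<Rightarrow> 'x \<Rightarrow> 'x \<Rightarrow> 'a \<Rightarrow> 'a \<Rightarrow> 'a" where
  "elcomp V A a b c g f =
     ecomp A a b c \<cdot>\<^bsub>V\<^esub> (g \<odot>\<^bsub>V\<^esub> f) \<cdot>\<^bsub>V\<^esub> inverse_arr V (lun V (unt V))"

definition self :: "('o, 'a, 'r) smc_category_scheme \<Rightarrow> ('o, 'o, 'a) ecategory" where
  "self V = \<lparr>
     eobj = Obj V,
     ehom = ihom V,
     ecomp = (\<lambda>A B D. curry_arr V (ihom V B D \<boxtimes>\<^bsub>V\<^esub> ihom V A B) A D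
        (ev V B D \<cdot>\<^bsub>V\<^esub> (Id V (ihom V B D) \<odot>\<^bsub>V\<^esub> ev V A B) \<cdot>\<^bsub>V\<^esub>
           asc V (ihom V B D) (ihom V A B) A)),
     eid = (\<lambda>A. curry_arr V (unt V) A A (lun V A)) \<rparr>"

text \<open>The element \<open>I \<rightarrow> [A,B]\<close> corresponding to an arrow \<open>A \<rightarrow> B\<close>, and conversely.\<close>

definition name_arr :: "('o, 'a, 'r) smc_category_scheme \<Rightarrow> 'a \<Rightarrow> 'a" where
  "name_arr V f = curry_arr V (unt V) (Dom V f) (Cod V f) (f \<cdot>\<^bsub>V\<^esub> lun V (Dom V f))"

definition unname_arr :: "('o, 'a, 'r) smc_category_scheme \<Rightarrow> 'o \<Rightarrow> 'o \<Rightarrow> 'a \<Rightarrow> 'a" where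
  "unname_arr V A B e = uncurry_arr V A B e \<cdot>\<^bsub>V\<^esub> inverse_arr V (lun V A)"

record ('x, 'y, 'a) efunctor =
  fobj :: "'x \<Rightarrow> 'y"
  fhom :: "'x \<Rightarrow> 'x \<Rightarrow> 'a"

definition enriched_functor ::
  "('o, 'a, 'r) smc_category_scheme \<Rightarrow> ('x, 'o, 'a) ecategory \<Rightarrow> ('y, 'o, 'a) ecategory \<Rightarrow>
     ('x, 'y, 'a, 's) efunctor_scheme \<Rightarrow> bool" where
  "enriched_functor V A B F \<longleftrightarrow>
     enriched_category V A \<and> enriched_category V B \<and>
     (\<forall>a \<in> eobj A. fobj F a \<in> eobj B) \<and>
     (\<forall>a \<in> eobj A. \<forall>b \<in> eobj A.
        fhom F a b \<in> Hom V (ehom A a b) (ehom B (fobj F a) (fobj F b))) \<and>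
     (\<forall>a \<in> eobj A. fhom F a a \<cdot>\<^bsub>V\<^esub> eid A a = eid B (fobj F a)) \<and>
     (\<forall>a \<in> eobj A. \<forall>b \<in> eobj A. \<forall>c \<in> eobj A.
        fhom F a c \<cdot>\<^bsub>V\<^esub> ecomp A a b c =
        ecomp B (fobj F a) (fobj F b) (fobj F c) \<cdot>\<^bsub>V\<^esub> (fhom F b c \<odot>\<^bsub>V\<^esub> fhom F a b))"

definition id_functor ::
  "('o, 'a, 'r) smc_category_scheme \<Rightarrow> ('x, 'o, 'a) ecategory \<Rightarrow> ('x, 'x, 'a) efunctor" where
  "id_functor V A = \<lparr> fobj = (\<lambda>a. a), fhom = (\<lambda>a b. Id V (ehom A a b)) \<rparr>"

definition comp_functor ::
  "('o, 'a, 'r) smc_category_scheme \<Rightarrow> ('y, 'z, 'a, 's) efunctor_scheme \<Rightarrow>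
     ('x, 'y, 'a, 't) efunctor_scheme \<Rightarrow> ('x, 'z, 'a) efunctor" where
  "comp_functor V F G = \<lparr>
     fobj = (\<lambda>a. fobj F (fobj G a)),
     fhom = (\<lambda>a b. fhom F (fobj G a) (fobj G b) \<cdot>\<^bsub>V\<^esub> fhom G a b) \<rparr>"

definition enriched_natural ::
  "('o, 'a, 'r) smc_category_scheme \<Rightarrow> ('x, 'o, 'a) ecategory \<Rightarrow> ('y, 'o, 'a) ecategory \<Rightarrow>
     ('x, 'y, 'a, 's) efunctor_scheme \<Rightarrow> ('x, 'y, 'a, 't) efunctor_scheme \<Rightarrow> ('x \<Rightarrow> 'a) \<Rightarrow> bool" where
  "enriched_natural V A B F G \<tau> \<longleftrightarrow>
     (\<forall>a \<in> eobj A. \<tau> a \<in> Hom V (unt V) (ehom B (fobj F a) (fobj G a))) \<and>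
     (\<forall>a \<in> eobj A. \<forall>b \<in> eobj A.
        ecomp B (fobj F a) (fobj F b) (fobj G b) \<cdot>\<^bsub>V\<^esub> (\<tau> b \<odot>\<^bsub>V\<^esub> fhom F a b) \<cdot>\<^bsub>V\<^esub>
          inverse_arr V (lun V (ehom A a b)) =
        ecomp B (fobj F a) (fobj G a) (fobj G b) \<cdot>\<^bsub>V\<^esub> (fhom G a b \<odot>\<^bsub>V\<^esub> \<tau> a) \<cdot>\<^bsub>V\<^esub>
          inverse_arr V (run V (ehom A a b)))"

text \<open>The components of a monad are elements \<open>munit T a : I \<rightarrow> A(a,Ta)\<close> and
  \<open>mmult T a : I \<rightarrow> A(TTa,Ta)\<close>, which makes sense on any enriched category.  On \<open>self V\<close> it is
  more convenient to let the components be arrows \<open>a \<rightarrow> Ta\<close> and \<open>TTa \<rightarrow> Ta\<close> of \<open>V\<close>;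
  \<open>elements V\<close> converts such data to elements.\<close>

record ('x, 'a) emonad = "('x, 'x, 'a) efunctor" +
  munit :: "'x \<Rightarrow> 'a"
  mmult :: "'x \<Rightarrow> 'a"

definition elements ::
  "('o, 'a, 'r) smc_category_scheme \<Rightarrow> ('o, 'a) emonad \<Rightarrow> ('o, 'a) emonad" where
  "elements V T = T\<lparr> munit := (\<lambda>A. name_arr V (munit T A)),
                     mmult := (\<lambda>A. name_arr V (mmult T A)) \<rparr>"

definition enriched_monad ::
  "('o, 'a, 'r) smc_category_scheme \<Rightarrow> ('x, 'o, 'a) ecategory \<Rightarrow> ('x, 'a) emonad \<Rightarrow> bool" where
  "enriched_monad V A T \<longleftrightarrow>
     enriched_functor V A A T \<and>
     enriched_natural V A A (id_functor V A) T (munit T) \<and>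
     enriched_natural V A A (comp_functor V T T) T (mmult T) \<and>
     (\<forall>a \<in> eobj A.
        let t = fobj T a; tt = fobj T t; ttt = fobj T tt in
        elcomp V A t tt t (mmult T a) (munit T t) = eid A t \<and>
        elcomp V A t tt t (mmult T a) (fhom T a t \<cdot>\<^bsub>V\<^esub> munit T a) = eid A t \<and>
        elcomp V A ttt tt t (mmult T a) (mmult T t) =
        elcomp V A ttt tt t (mmult T a) (fhom T tt t \<cdot>\<^bsub>V\<^esub> mmult T a))"

text \<open>A monad on the enriched category \<open>self V\<close>, with arrows of \<open>V\<close> as components.\<close>

definition self_monad ::
  "('o, 'a, 'r) smc_category_scheme \<Rightarrow> ('o, 'a) emonad \<Rightarrow> bool" where
  "self_monad V T \<longleftrightarrow>
     (\<forall>A \<in> Obj V. munit T A \<in> Hom V A (fobj T A) \<and>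
        mmult T A \<in> Hom V (fobj T (fobj T A)) (fobj T A)) \<and>
     enriched_monad V (self V) (elements V T)"

text \<open>A morphism \<open>(\<lambda>,Q) : T \<rightarrow> S\<close>, where \<open>T\<close> lives on \<open>A\<close>, \<open>S\<close> on \<open>B\<close> and
  \<open>Q : B \<rightarrow> A\<close>; the two equations are \<open>\<lambda> \<cdot> \<eta>Q = Q\<phi>\<close> and
  \<open>\<lambda> \<cdot> \<mu>Q = Q\<nu> \<cdot> \<lambda>S \<cdot> T\<lambda>\<close>.\<close>

definition monad_morphism ::
  "('o, 'a, 'r) smc_category_scheme \<Rightarrow> ('x, 'o, 'a) ecategory \<Rightarrow> ('x, 'a) emonad \<Rightarrow>
     ('y, 'o, 'a) ecategory \<Rightarrow> ('y, 'a) emonad \<Rightarrow> ('y, 'x, 'a) efunctor \<Rightarrow> ('y \<Rightarrow> 'a) \<Rightarrow> bool" where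
  "monad_morphism V A T B S Q l \<longleftrightarrow>
     enriched_functor V B A Q \<and>
     enriched_natural V B A (comp_functor V T Q) (comp_functor V Q S) l \<and>
     (\<forall>b \<in> eobj B.
        let q = fobj Q b; sb = fobj S b; ssb = fobj S sb; qs = fobj Q sb; qss = fobj Q ssb;
            t = fobj T q; tt = fobj T t; tqs = fobj T qs in
        elcomp V A q t qs (l b) (munit T q) = fhom Q b sb \<cdot>\<^bsub>V\<^esub> munit S b \<and>
        elcomp V A tt t qs (l b) (mmult T q) =
        elcomp V A tt qss qs (fhom Q ssb sb \<cdot>\<^bsub>V\<^esub> mmult S b)
          (elcomp V A tt tqs qss (l sb) (fhom T t qs \<cdot>\<^bsub>V\<^esub> l b)))"

text \<open>Effect of an enriched endofunctor of \<open>self V\<close> on an arrow of \<open>V\<close>.\<close>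

definition arr_map ::
  "('o, 'a, 'r) smc_category_scheme \<Rightarrow> ('o, 'o, 'a, 's) efunctor_scheme \<Rightarrow> 'a \<Rightarrow> 'a" where
  "arr_map V T f = unname_arr V (fobj T (Dom V f)) (fobj T (Cod V f))
     (fhom T (Dom V f) (Cod V f) \<cdot>\<^bsub>V\<^esub> name_arr V f)"


section \<open>Double dualization\<close>

abbreviation (input) dual :: "('o, 'a, 'r) smc_category_scheme \<Rightarrow> 'o \<Rightarrow> 'o \<Rightarrow> 'o" where
  "dual V R E \<equiv> ihom V E R"

text \<open>The structure arrow \<open>[E,E'] \<rightarrow> [[E',R],[E,R]]\<close> of the enriched functor
  \<open>[-,R] : self V\<^sup>o\<^sup>p \<rightarrow> self V\<close>.\<close>

definition dual_hom :: "('o, 'a, 'r) smc_category_scheme \<Rightarrow> 'o \<Rightarrow> 'o \<Rightarrow> 'o \<Rightarrow> 'a" where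
  "dual_hom V R E E' = curry_arr V (ihom V E E') (dual V R E') (dual V R E)
     (ecomp (self V) E E' R \<cdot>\<^bsub>V\<^esub> brd V (ihom V E E') (dual V R E'))"

text \<open>The unit \<open>E \<rightarrow> E\<^sup>*\<^sup>*\<close> of the adjunction, the transpose of
  \<open>E \<otimes> E\<^sup>* \<cong> E\<^sup>* \<otimes> E \<rightarrow> R\<close>.\<close>

definition dd_unit :: "('o, 'a, 'r) smc_category_scheme \<Rightarrow> 'o \<Rightarrow> 'o \<Rightarrow> 'a" where
  "dd_unit V R E = curry_arr V E (dual V R E) R (ev V E R \<cdot>\<^bsub>V\<^esub> brd V E (dual V R E))"

text \<open>The counit of the adjunction at \<open>D\<close>, as an arrow of \<open>V\<close>, is again \<open>dd_unit V R D\<close>; the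
  multiplication is \<open>[-,R]\<close> applied to the counit at \<open>E\<^sup>*\<close>.\<close>

definition dd_monad :: "('o, 'a, 'r) smc_category_scheme \<Rightarrow> 'o \<Rightarrow> ('o, 'a) emonad" where
  "dd_monad V R = \<lparr>
     fobj = (\<lambda>E. dual V R (dual V R E)),
     fhom = (\<lambda>E E'. dual_hom V R (dual V R E') (dual V R E) \<cdot>\<^bsub>V\<^esub> dual_hom V R E E'),
     munit = dd_unit V R,
     mmult = (\<lambda>E. precomp V (dd_unit V R (dual V R E)) R) \<rparr>"

text \<open>Change of base along a lax monoidal functor with unit constraint \<open>u0\<close>, for monads with
  elements as components.\<close>

definition base_change ::
  "('o, 'a, 'r) smc_category_scheme \<Rightarrow> ('b \<Rightarrow> 'a) \<Rightarrow> 'a \<Rightarrow> ('x, 'b) emonad \<Rightarrow> ('x, 'a) emonad" where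
  "base_change X Ga u0 T = \<lparr>
     fobj = fobj T,
     fhom = (\<lambda>a b. Ga (fhom T a b)),
     munit = (\<lambda>a. Ga (munit T a) \<cdot>\<^bsub>X\<^esub> u0),
     mmult = (\<lambda>a. Ga (mmult T a) \<cdot>\<^bsub>X\<^esub> u0) \<rparr>"


section \<open>Commutative monads\<close>

text \<open>The strengths \<open>TA \<boxtimes> B \<rightarrow> T(A \<boxtimes> B)\<close> and \<open>A \<boxtimes> TB \<rightarrow> T(A \<boxtimes> B)\<close>.\<close>

definition str1 :: "('o, 'a, 'r) smc_category_scheme \<Rightarrow> ('o, 'a) emonad \<Rightarrow> 'o \<Rightarrow> 'o \<Rightarrow> 'a" where
  "str1 X T A B =
     uncurry_arr X (fobj T A) (fobj T (A \<boxtimes>\<^bsub>X\<^esub> B))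
       (fhom T A (A \<boxtimes>\<^bsub>X\<^esub> B) \<cdot>\<^bsub>X\<^esub> curry_arr X B A (A \<boxtimes>\<^bsub>X\<^esub> B) (brd X B A)) \<cdot>\<^bsub>X\<^esub>
     brd X (fobj T A) B"

definition str2 :: "('o, 'a, 'r) smc_category_scheme \<Rightarrow> ('o, 'a) emonad \<Rightarrow> 'o \<Rightarrow> 'o \<Rightarrow> 'a" where
  "str2 X T A B =
     uncurry_arr X (fobj T B) (fobj T (A \<boxtimes>\<^bsub>X\<^esub> B))
       (fhom T B (A \<boxtimes>\<^bsub>X\<^esub> B) \<cdot>\<^bsub>X\<^esub> curry_arr X A B (A \<boxtimes>\<^bsub>X\<^esub> B) (Id X (A \<boxtimes>\<^bsub>X\<^esub> B)))"

definition mon_tensor ::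
  "('o, 'a, 'r) smc_category_scheme \<Rightarrow> ('o, 'a) emonad \<Rightarrow> 'o \<Rightarrow> 'o \<Rightarrow> 'a" where
  "mon_tensor X T A B =
     mmult T (A \<boxtimes>\<^bsub>X\<^esub> B) \<cdot>\<^bsub>X\<^esub> arr_map X T (str1 X T A B) \<cdot>\<^bsub>X\<^esub> str2 X T (fobj T A) B"

definition commutative_monad ::
  "('o, 'a, 'r) smc_category_scheme \<Rightarrow> ('o, 'a) emonad \<Rightarrow> bool" where
  "commutative_monad X T \<longleftrightarrow> self_monad X T \<and>
     (\<forall>A \<in> Obj X. \<forall>B \<in> Obj X.
        mon_tensor X T A B =
        mmult T (A \<boxtimes>\<^bsub>X\<^esub> B) \<cdot>\<^bsub>X\<^esub> arr_map X T (str2 X T A B) \<cdot>\<^bsub>X\<^esub> str1 X T A (fobj T B))"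


section \<open>Algebras\<close>

datatype ('o, 'a) alg = Alg (carrier: 'o) (struc: 'a)

datatype ('o, 'a) lin = Lin (src: "('o, 'a) alg") (lmap: 'a) (tgt: "('o, 'a) alg")

definition algebras ::
  "('o, 'a, 'r) smc_category_scheme \<Rightarrow> ('o, 'a) emonad \<Rightarrow> ('o, 'a) alg set" where
  "algebras X T = {Alg A a | A a. A \<in> Obj X \<and> a \<in> Hom X (fobj T A) A \<and>
     a \<cdot>\<^bsub>X\<^esub> munit T A = Id X A \<and> a \<cdot>\<^bsub>X\<^esub> mmult T A = a \<cdot>\<^bsub>X\<^esub> arr_map X T a}"

definition EM ::
  "('o, 'a, 'r) smc_category_scheme \<Rightarrow> ('o, 'a) emonad \<Rightarrow> (('o, 'a) alg, ('o, 'a) lin) category" where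
  "EM X T = \<lparr>
     Obj = algebras X T,
     Arr = {Lin A f B | A f B. A \<in> algebras X T \<and> B \<in> algebras X T \<and>
        f \<in> Hom X (carrier A) (carrier B) \<and>
        f \<cdot>\<^bsub>X\<^esub> struc A = struc B \<cdot>\<^bsub>X\<^esub> arr_map X T f},
     Dom = src,
     Cod = tgt,
     Id = (\<lambda>A. Lin A (Id X (carrier A)) A),
     Comp = (\<lambda>g f. Lin (src f) (lmap g \<cdot>\<^bsub>X\<^esub> lmap f) (tgt g)) \<rparr>"

definition free_alg :: "('o, 'a) emonad \<Rightarrow> 'o \<Rightarrow> ('o, 'a) alg" where
  "free_alg T A = Alg (fobj T A) (mmult T A)"

text \<open>The two linear maps whose coequalizer is the tensor product of two algebras.\<close>

definition tensor_pair1 ::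
  "('o, 'a, 'r) smc_category_scheme \<Rightarrow> ('o, 'a) emonad \<Rightarrow> ('o, 'a) alg \<Rightarrow> ('o, 'a) alg \<Rightarrow> ('o, 'a) lin" where
  "tensor_pair1 X T A B =
     Lin (free_alg T (fobj T (carrier A) \<boxtimes>\<^bsub>X\<^esub> fobj T (carrier B)))
       (mmult T (carrier A \<boxtimes>\<^bsub>X\<^esub> carrier B) \<cdot>\<^bsub>X\<^esub>
          arr_map X T (mon_tensor X T (carrier A) (carrier B)))
       (free_alg T (carrier A \<boxtimes>\<^bsub>X\<^esub> carrier B))"

definition tensor_pair2 ::
  "('o, 'a, 'r) smc_category_scheme \<Rightarrow> ('o, 'a) emonad \<Rightarrow> ('o, 'a) alg \<Rightarrow> ('o, 'a) alg \<Rightarrow> ('o, 'a) lin" where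
  "tensor_pair2 X T A B =
     Lin (free_alg T (fobj T (carrier A) \<boxtimes>\<^bsub>X\<^esub> fobj T (carrier B)))
       (arr_map X T (struc A \<odot>\<^bsub>X\<^esub> struc B))
       (free_alg T (carrier A \<boxtimes>\<^bsub>X\<^esub> carrier B))"

text \<open>The Eilenberg--Moore enriched category, given for each pair of algebras a choice of
  hom-object \<open>h A B\<close> and inclusion \<open>i A B : h A B \<rightarrow> [carrier A, carrier B]\<close>, namely an equalizer
  of the two arrows below.\<close>

definition em_pair1 ::
  "('o, 'a, 'r) smc_category_scheme \<Rightarrow> ('o, 'a) alg \<Rightarrow> ('o, 'a) alg \<Rightarrow> 'a" where
  "em_pair1 X A B = precomp X (struc A) (carrier B)"

definition em_pair2 ::
  "('o, 'a, 'r) smc_category_scheme \<Rightarrow> ('o, 'a) emonad \<Rightarrow> ('o, 'a) alg \<Rightarrow> ('o, 'a) alg \<Rightarrow> 'a" where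
  "em_pair2 X T A B =
     postcomp X (fobj T (carrier A)) (struc B) \<cdot>\<^bsub>X\<^esub> fhom T (carrier A) (carrier B)"

definition em_ecategory ::
  "('o, 'a, 'r) smc_category_scheme \<Rightarrow> ('o, 'a) emonad \<Rightarrow>
     (('o, 'a) alg \<Rightarrow> ('o, 'a) alg \<Rightarrow> 'o) \<Rightarrow> (('o, 'a) alg \<Rightarrow> ('o, 'a) alg \<Rightarrow> 'a) \<Rightarrow>
     (('o, 'a) alg, 'o, 'a) ecategory" where
  "em_ecategory X T h i = \<lparr>
     eobj = algebras X T,
     ehom = h,
     ecomp = (\<lambda>A B D. THE c. c \<in> Hom X (h B D \<boxtimes>\<^bsub>X\<^esub> h A B) (h A D) \<and>
        i A D \<cdot>\<^bsub>X\<^esub> c =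
        ecomp (self X) (carrier A) (carrier B) (carrier D) \<cdot>\<^bsub>X\<^esub> (i B D \<odot>\<^bsub>X\<^esub> i A B)),
     eid = (\<lambda>A. THE e. e \<in> Hom X (unt X) (h A A) \<and>
        i A A \<cdot>\<^bsub>X\<^esub> e = eid (self X) (carrier A)) \<rparr>"

definition em_forget ::
  "(('o, 'a) alg \<Rightarrow> ('o, 'a) alg \<Rightarrow> 'a) \<Rightarrow> (('o, 'a) alg, 'o, 'a) efunctor" where
  "em_forget i = \<lparr> fobj = carrier, fhom = i \<rparr>"


section \<open>Linear spaces\<close>

text \<open>\<open>LS\<close> is the closed symmetric monoidal category of algebras.  The tensor product is given
  by a coequalizer \<open>q A B : F(carrier A \<boxtimes> carrier B) \<rightarrow> A \<otimes> B\<close>, whence the universal bilinear map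
  \<open>bilin X L q A B\<close>.  The remaining structure is tied to that of \<open>X\<close> by requiring that the forgetful
  functor be symmetric monoidal, with these maps and \<open>\<eta>\<close> as constraints, and that evaluation
  be the restriction of evaluation in \<open>X\<close>; this determines associativity, units, symmetry,
  the algebra structure of the internal hom and evaluation.\<close>

definition bilin ::
  "('o, 'a, 'r) smc_category_scheme \<Rightarrow> ('o, 'a) emonad \<Rightarrow>
     (('o, 'a) alg \<Rightarrow> ('o, 'a) alg \<Rightarrow> ('o, 'a) lin) \<Rightarrow> ('o, 'a) alg \<Rightarrow> ('o, 'a) alg \<Rightarrow> 'a" where
  "bilin X T q A B = lmap (q A B) \<cdot>\<^bsub>X\<^esub> munit T (carrier A \<boxtimes>\<^bsub>X\<^esub> carrier B)"

locale linear_spaces = smc_category X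
  for X :: "('o, 'a) smc_category" (structure) +
  fixes L :: "('o, 'a) emonad"
    and h :: "('o, 'a) alg \<Rightarrow> ('o, 'a) alg \<Rightarrow> 'o"
    and i :: "('o, 'a) alg \<Rightarrow> ('o, 'a) alg \<Rightarrow> 'a"
    and q :: "('o, 'a) alg \<Rightarrow> ('o, 'a) alg \<Rightarrow> ('o, 'a) lin"
    and LS :: "(('o, 'a) alg, ('o, 'a) lin) smc_category"
  assumes well_complete: "finitely_well_complete X"
    and commutative: "commutative_monad X L"
    and em_hom: "\<lbrakk>A \<in> algebras X L; B \<in> algebras X L\<rbrakk> \<Longrightarrow>
      is_equalizer X (em_pair1 X A B) (em_pair2 X L A B) (i A B) \<and> Dom X (i A B) = h A B"
    and LS_smc: "smc_category LS"
    and LS_cat: "category.truncate LS = EM X L"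
    and LS_tens: "\<lbrakk>A \<in> algebras X L; B \<in> algebras X L\<rbrakk> \<Longrightarrow>
      is_coequalizer (EM X L) (tensor_pair1 X L A B) (tensor_pair2 X L A B) (q A B) \<and>
      Cod LS (q A B) = A \<boxtimes>\<^bsub>LS\<^esub> B"
    and LS_unt: "unt LS = free_alg L (unt X)"
    and LS_forget: "lax_symmetric_monoidal LS X carrier lmap (bilin X L q) (munit L (unt X))"
    and LS_ihom: "\<lbrakk>A \<in> algebras X L; B \<in> algebras X L\<rbrakk> \<Longrightarrow> carrier (ihom LS A B) = h A B"
    and LS_ev: "\<lbrakk>A \<in> algebras X L; B \<in> algebras X L\<rbrakk> \<Longrightarrow>
      lmap (ev LS A B) \<cdot> bilin X L q (ihom LS A B) A =
      uncurry_arr X (carrier A) (carrier B) (i A B)"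

definition lin_dd :: "(('o, 'a) alg, ('o, 'a) lin) smc_category \<Rightarrow> (('o, 'a) alg, ('o, 'a) lin) emonad" where
  "lin_dd LS = dd_monad LS (unt LS)"

definition separated :: "(('o, 'a) alg, ('o, 'a) lin) smc_category \<Rightarrow> ('o, 'a) alg \<Rightarrow> bool" where
  "separated LS E \<longleftrightarrow> strong_mono LS (munit (lin_dd LS) E)"

text \<open>The double-dualization monad as a monad on the enriched category \<open>em_ecategory X L h i\<close>.\<close>

definition lin_dd_enriched ::
  "('o, 'a) smc_category \<Rightarrow> ('o, 'a) emonad \<Rightarrow> (('o, 'a) alg, ('o, 'a) lin) smc_category \<Rightarrow>
     (('o, 'a) alg, 'a) emonad" where
  "lin_dd_enriched X L LS = base_change X lmap (munit L (unt X)) (elements LS (lin_dd LS))"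

text \<open>The counit of the Eilenberg--Moore adjunction at \<open>E\<close> is the structure map of \<open>E\<close>.\<close>

definition canonical_zeta ::
  "('o, 'a) smc_category \<Rightarrow> (('o, 'a) alg, ('o, 'a) lin) smc_category \<Rightarrow> ('o, 'a) alg \<Rightarrow> 'a" where
  "canonical_zeta X LS E = lmap (munit (lin_dd LS) E) \<cdot>\<^bsub>X\<^esub> struc E"

locale abstract_distribution_monad = linear_spaces X L h i q LS
  for X :: "('o, 'a) smc_category" (structure) and L h i q LS +
  fixes M :: "('o, 'a) emonad"
    and \<Delta> :: "'o \<Rightarrow> 'a"
    and \<xi> :: "('o, 'a) alg \<Rightarrow> 'a"
  assumes M_monad: "self_monad X M"
    and Delta_hom: "A \<in> Obj X \<Longrightarrow> \<Delta> A \<in> Hom X (fobj L A) (fobj M A)"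
    and Delta_morphism:
      "monad_morphism X (self X) (elements X L) (self X) (elements X M)
         (id_functor X (self X)) (\<lambda>A. name_arr X (\<Delta> A))"
    and xi_hom: "E \<in> algebras X L \<Longrightarrow>
      \<xi> E \<in> Hom X (fobj M (carrier E)) (carrier (fobj (lin_dd LS) E))"
    and xi_morphism:
      "monad_morphism X (self X) (elements X M) (em_ecategory X L h i) (lin_dd_enriched X L LS)
         (em_forget i) (\<lambda>E. name_arr X (\<xi> E))"
    and xi_Delta: "E \<in> algebras X L \<Longrightarrow> \<xi> E \<cdot> \<Delta> (carrier E) = canonical_zeta X LS E"

definition is_Pettis_structure ::
  "('o, 'a) smc_category \<Rightarrow> (('o, 'a) alg, ('o, 'a) lin) smc_category \<Rightarrow> ('o, 'a) emonad \<Rightarrow>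
     (('o, 'a) alg \<Rightarrow> 'a) \<Rightarrow> ('o, 'a) alg \<Rightarrow> 'a \<Rightarrow> bool" where
  "is_Pettis_structure X LS M \<xi> E a \<longleftrightarrow>
     a \<in> Hom X (fobj M (carrier E)) (carrier E) \<and>
     lmap (munit (lin_dd LS) E) \<cdot>\<^bsub>X\<^esub> a = \<xi> E"

definition Pettis ::
  "('o, 'a) smc_category \<Rightarrow> (('o, 'a) alg, ('o, 'a) lin) smc_category \<Rightarrow> ('o, 'a) emonad \<Rightarrow>
     (('o, 'a) alg \<Rightarrow> 'a) \<Rightarrow> ('o, 'a) alg \<Rightarrow> bool" where
  "Pettis X LS M \<xi> E \<longleftrightarrow> E \<in> Obj LS \<and> separated LS E \<and> (\<exists>a. is_Pettis_structure X LS M \<xi> E a)"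

definition Pettis_structure ::
  "('o, 'a) smc_category \<Rightarrow> (('o, 'a) alg, ('o, 'a) lin) smc_category \<Rightarrow> ('o, 'a) emonad \<Rightarrow>
     (('o, 'a) alg \<Rightarrow> 'a) \<Rightarrow> ('o, 'a) alg \<Rightarrow> 'a" where
  "Pettis_structure X LS M \<xi> E = (THE a. is_Pettis_structure X LS M \<xi> E a)"

end

theory Submission
  imports Defs
begin

text \<open>Forgetful functors of algebras preserve monomorphisms, so the two algebra laws for the Pettis
  structure \<open>a\<close> of \<open>E\<close> may be checked after composing with the canonical map \<open>d : E \<rightarrow> E\<^sup>*\<^sup>*\<close>.
  There \<open>d \<cdot> a = \<xi>\<close>, and the unit law becomes the unit law of the monad morphism \<open>\<xi>\<close>.  For
  associativity, with \<open>k\<close> the multiplication of the double-dualization monad \<open>H\<close>,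
  \<open>\<xi>\<^sub>E \<cdot> \<kappa> = k \<cdot> \<xi>\<^bsub>HE\<^esub> \<cdot> M\<xi>\<^sub>E = k \<cdot> \<xi>\<^bsub>HE\<^esub> \<cdot> Md \<cdot> Ma = k \<cdot> Hd \<cdot> \<xi>\<^sub>E \<cdot> Ma = \<xi>\<^sub>E \<cdot> Ma\<close>
  by naturality of \<open>\<xi>\<close> at \<open>d\<close> and the monad law \<open>k \<cdot> Hd = 1\<close>.  All hypotheses are
  enriched, so they are first evaluated at elements \<open>I \<rightarrow> A(a,b)\<close>, which needs Kelly's coherence
  results for the unit object.\<close>

section \<open>Coherence in symmetric monoidal categories\<close>

context category
begin

lemma mem_Hom_iff: "f \<in> Hom C A B \<longleftrightarrow> f \<in> Arr C \<and> Dom C f = A \<and> Cod C f = B"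
  by (simp add: Hom_def)

lemma HomD:
  assumes "f \<in> Hom C A B"
  shows "f \<in> Arr C" "Dom C f = A" "Cod C f = B" "A \<in> Obj C" "B \<in> Obj C"
  using assms dom_obj cod_obj by (auto simp: Hom_def)

lemma HomI: "\<lbrakk>f \<in> Arr C; Dom C f = A; Cod C f = B\<rbrakk> \<Longrightarrow> f \<in> Hom C A B"
  by (simp add: Hom_def)

lemma id_simps [simp]:
  assumes "A \<in> Obj C"
  shows "Id C A \<in> Arr C" "Dom C (Id C A) = A" "Cod C (Id C A) = A"
  using id_hom[OF assms] by (auto simp: Hom_def)

lemma comp_simps [simp]:
  assumes "g \<in> Arr C" "f \<in> Arr C" "Dom C g = Cod C f"
  shows "g \<cdot> f \<in> Arr C" "Dom C (g \<cdot> f) = Dom C f" "Cod C (g \<cdot> f) = Cod C g"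
  using comp_hom[of g "Cod C f" "Cod C g" f "Dom C f"] assms by (auto simp: Hom_def)

lemma comp_id_simps [simp]:
  assumes "f \<in> Arr C"
  shows "Cod C f = B \<Longrightarrow> Id C B \<cdot> f = f" "Dom C f = A \<Longrightarrow> f \<cdot> Id C A = f"
  using comp_id_left[of f "Dom C f"] comp_id_right[of f _ "Cod C f"] assms by (auto simp: Hom_def)

text \<open>Composites are normalised to right-nested form. Typing is expressed by equations on
  \<open>Dom\<close> and \<open>Cod\<close> instead of membership in \<open>Hom\<close>, so the
  simplifier can discharge it without guessing intermediate objects.\<close>

lemma comp_assoc_simp [simp]:
  assumes "k \<in> Arr C" "g \<in> Arr C" "f \<in> Arr C" "Dom C k = Cod C g" "Dom C g = Cod C f"
  shows "(k \<cdot> g) \<cdot> f = k \<cdot> g \<cdot> f"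
  using comp_assoc[of k "Cod C g" "Cod C k" g "Cod C f" f "Dom C f"] assms
  by (auto simp: Hom_def)

text \<open>In a right-nested composite the product \<open>a \<cdot> b\<close> is usually not a
  subterm, so an equation for it cannot be applied directly. This form carries the remaining tail
  \<open>x\<close> along.\<close>

lemma comp_cong_tail:
  assumes "a \<cdot> b = c"
    and "a \<in> Arr C" "b \<in> Arr C" "x \<in> Arr C" "Dom C a = Cod C b" "Dom C b = Cod C x"
  shows "a \<cdot> b \<cdot> x = c \<cdot> x"
  using comp_assoc_simp[of a b x] assms by simp

text \<open>The definite description is justified by uniqueness: two inverses \<open>g\<close> and
  \<open>k\<close> of \<open>f\<close> both equal \<open>g \<cdot> f \<cdot> k\<close>.\<close>

lemma inverse_arr:
  assumes "invertible C f"
  shows "inverse_arr C f \<in> Hom C (Cod C f) (Dom C f)"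
    and "inverse_arr C f \<cdot> f = Id C (Dom C f)"
    and "f \<cdot> inverse_arr C f = Id C (Cod C f)"
proof -
  have f: "f \<in> Arr C"
    using assms by (simp add: invertible_def)
  let ?P = "\<lambda>g. g \<in> Hom C (Cod C f) (Dom C f) \<and> g \<cdot> f = Id C (Dom C f) \<and> f \<cdot> g = Id C (Cod C f)"
  have "\<exists>!g. ?P g"
  proof (rule ex_ex1I)
    show "\<exists>g. ?P g"
      using assms by (auto simp: invertible_def)
    fix g k assume g: "?P g" and k: "?P k"
    have "g = g \<cdot> f \<cdot> k"
      using g k f by (simp add: Hom_def)
    also have "\<dots> = (g \<cdot> f) \<cdot> k"
      using g k f comp_assoc_simp[of g f k] by (simp add: Hom_def)
    also have "\<dots> = k"
      using g k f by (simp add: Hom_def)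
    finally show "g = k" .
  qed
  then have "?P (inverse_arr C f)"
    unfolding inverse_arr_def by (rule theI')
  then show "inverse_arr C f \<in> Hom C (Cod C f) (Dom C f)"
    and "inverse_arr C f \<cdot> f = Id C (Dom C f)"
    and "f \<cdot> inverse_arr C f = Id C (Cod C f)"
    by auto
qed

lemma inverse_simps [simp]:
  assumes "invertible C f"
  shows "inverse_arr C f \<in> Arr C" "Dom C (inverse_arr C f) = Cod C f"
    "Cod C (inverse_arr C f) = Dom C f"
  using inverse_arr(1)[OF assms] by (auto simp: Hom_def)

lemma iso_cancel_right:
  assumes "invertible C e" and "f \<in> Arr C" "g \<in> Arr C" "Dom C f = Cod C e" "Dom C g = Cod C e"
    and "f \<cdot> e = g \<cdot> e"
  shows "f = g"
proof -
  have e: "e \<in> Arr C"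
    using assms(1) by (simp add: invertible_def)
  have "(f \<cdot> e) \<cdot> inverse_arr C e = (g \<cdot> e) \<cdot> inverse_arr C e"
    by (simp add: assms(6))
  then show ?thesis
    using assms(1-5) e by (simp add: inverse_arr(3))
qed

lemma iso_cancel_left:
  assumes "invertible C e" and "f \<in> Arr C" "g \<in> Arr C" "Cod C f = Dom C e" "Cod C g = Dom C e"
    and "e \<cdot> f = e \<cdot> g"
  shows "f = g"
proof -
  have e: "e \<in> Arr C"
    using assms(1) by (simp add: invertible_def)
  have "inverse_arr C e \<cdot> e \<cdot> f = f" "inverse_arr C e \<cdot> e \<cdot> g = g"
    using assms(1-5) e by (simp_all add: comp_cong_tail[OF inverse_arr(2)])
  then show ?thesis
    using assms(6) by metis
qed

end

section \<open>Tensor calculus and coherence of the unit constraints\<close>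

context smc_category
begin

declare tens_obj [simp] unt_obj [simp] ihom_obj [simp] dom_obj [simp] cod_obj [simp]
  asc_inv [simp] lun_inv [simp] run_inv [simp] tensa_id [simp]

lemma tensa_simps [simp]:
  assumes "f \<in> Arr V" "g \<in> Arr V"
  shows "f \<odot> g \<in> Arr V" "Dom V (f \<odot> g) = Dom V f \<boxtimes> Dom V g"
    "Cod V (f \<odot> g) = Cod V f \<boxtimes> Cod V g"
  using tensa_hom[of f "Dom V f" "Cod V f" g "Dom V g" "Cod V g"] assms by (auto simp: Hom_def)

lemma structure_simps [simp]:
  assumes "A \<in> Obj V"
  shows "lun V A \<in> Arr V" "Dom V (lun V A) = unt V \<boxtimes> A" "Cod V (lun V A) = A"
    and "run V A \<in> Arr V" "Dom V (run V A) = A \<boxtimes> unt V" "Cod V (run V A) = A"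
    and "B \<in> Obj V \<Longrightarrow> brd V A B \<in> Arr V" "B \<in> Obj V \<Longrightarrow> Dom V (brd V A B) = A \<boxtimes> B"
      "B \<in> Obj V \<Longrightarrow> Cod V (brd V A B) = B \<boxtimes> A"
    and "B \<in> Obj V \<Longrightarrow> ev V A B \<in> Arr V" "B \<in> Obj V \<Longrightarrow> Dom V (ev V A B) = ihom V A B \<boxtimes> A"
      "B \<in> Obj V \<Longrightarrow> Cod V (ev V A B) = B"
    and "\<lbrakk>B \<in> Obj V; D \<in> Obj V\<rbrakk> \<Longrightarrow> asc V A B D \<in> Arr V"
      "\<lbrakk>B \<in> Obj V; D \<in> Obj V\<rbrakk> \<Longrightarrow> Dom V (asc V A B D) = (A \<boxtimes> B) \<boxtimes> D"
      "\<lbrakk>B \<in> Obj V; D \<in> Obj V\<rbrakk> \<Longrightarrow> Cod V (asc V A B D) = A \<boxtimes> (B \<boxtimes> D)"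
  using assms lun_hom[of A] run_hom[of A] brd_hom[of A B] ev_hom[of A B] asc_hom[of A B D]
  by (auto simp: Hom_def)

text \<open>Oriented so that rewriting fuses two tensors and pushes composition into the factors,
  where unit laws and inverses can act.\<close>

lemma interchange:
  assumes "f' \<in> Arr V" "f \<in> Arr V" "g' \<in> Arr V" "g \<in> Arr V" "Dom V f' = Cod V f" "Dom V g' = Cod V g"
  shows "(f' \<odot> g') \<cdot> (f \<odot> g) = (f' \<cdot> f) \<odot> (g' \<cdot> g)"
  using tensa_comp[of f "Dom V f" "Cod V f" f' "Cod V f'" g "Dom V g" "Cod V g" g' "Cod V g'"] assms
  by (auto simp: Hom_def)

lemma interchange_tail:
  assumes "f' \<in> Arr V" "f \<in> Arr V" "g' \<in> Arr V" "g \<in> Arr V" "Dom V f' = Cod V f" "Dom V g' = Cod V g"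
    "x \<in> Arr V" "Cod V x = Dom V f \<boxtimes> Dom V g"
  shows "(f' \<odot> g') \<cdot> (f \<odot> g) \<cdot> x = ((f' \<cdot> f) \<odot> (g' \<cdot> g)) \<cdot> x"
  using assms by (intro comp_cong_tail interchange) auto

lemma lun_natural: "f \<in> Arr V \<Longrightarrow> lun V (Cod V f) \<cdot> (Id V (unt V) \<odot> f) = f \<cdot> lun V (Dom V f)"
  by (rule lun_nat) (simp add: Hom_def)

lemma run_natural: "f \<in> Arr V \<Longrightarrow> run V (Cod V f) \<cdot> (f \<odot> Id V (unt V)) = f \<cdot> run V (Dom V f)"
  by (rule run_nat) (simp add: Hom_def)

lemma brd_natural: "\<lbrakk>f \<in> Arr V; g \<in> Arr V\<rbrakk>
    \<Longrightarrow> brd V (Cod V f) (Cod V g) \<cdot> (f \<odot> g) = (g \<odot> f) \<cdot> brd V (Dom V f) (Dom V g)"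
  by (rule brd_nat) (simp_all add: Hom_def)

lemma asc_natural: "\<lbrakk>f \<in> Arr V; g \<in> Arr V; k \<in> Arr V\<rbrakk>
    \<Longrightarrow> asc V (Cod V f) (Cod V g) (Cod V k) \<cdot> ((f \<odot> g) \<odot> k) =
      (f \<odot> (g \<odot> k)) \<cdot> asc V (Dom V f) (Dom V g) (Dom V k)"
  by (rule asc_nat) (simp_all add: Hom_def)

lemma invertible_tensor_id:
  assumes "invertible V f" "A \<in> Obj V"
  shows "invertible V (f \<odot> Id V A)"
proof -
  have f: "f \<in> Arr V"
    using assms(1) by (simp add: invertible_def)
  have "inverse_arr V f \<odot> Id V A \<in> Hom V (Cod V (f \<odot> Id V A)) (Dom V (f \<odot> Id V A))"
    using assms f by (simp add: mem_Hom_iff)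
  moreover have "(inverse_arr V f \<odot> Id V A) \<cdot> (f \<odot> Id V A) = Id V (Dom V (f \<odot> Id V A))"
    "(f \<odot> Id V A) \<cdot> (inverse_arr V f \<odot> Id V A) = Id V (Cod V (f \<odot> Id V A))"
    using assms f by (simp_all add: interchange inverse_arr)
  ultimately show ?thesis
    unfolding invertible_def using assms f by auto
qed

lemma invertible_comp:
  assumes "invertible V g" "invertible V f" "Dom V g = Cod V f"
  shows "invertible V (g \<cdot> f)"
proof -
  have f: "f \<in> Arr V" and g: "g \<in> Arr V"
    using assms by (auto simp add: invertible_def)
  have "(inverse_arr V f \<cdot> inverse_arr V g) \<cdot> g \<cdot> f = Id V (Dom V f)"
    using assms f g by (simp add: comp_cong_tail[OF inverse_arr(2)] inverse_arr(2))
  moreover have "(g \<cdot> f) \<cdot> inverse_arr V f \<cdot> inverse_arr V g = Id V (Cod V g)"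
    using assms f g by (simp add: comp_cong_tail[OF inverse_arr(3)] inverse_arr(3))
  ultimately show ?thesis
    unfolding invertible_def using assms f g
    by (auto intro!: bexI[of _ "inverse_arr V f \<cdot> inverse_arr V g"] HomI)
qed

text \<open>The natural isomorphism \<open>lun\<close> identifies tensoring with the unit with the
  identity functor, which is faithful.\<close>

lemma unt_tensor_faithful:
  assumes "f \<in> Arr V" "g \<in> Arr V" "Dom V f = Dom V g" "Cod V f = Cod V g"
    and "Id V (unt V) \<odot> f = Id V (unt V) \<odot> g"
  shows "f = g"
proof (rule iso_cancel_right[of "lun V (Dom V f)"])
  show "f \<cdot> lun V (Dom V f) = g \<cdot> lun V (Dom V f)"
    using lun_natural[of f] lun_natural[of g] assms by simp
qed (use assms in simp_all)

lemma tensor_unt_faithful: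
  assumes "f \<in> Arr V" "g \<in> Arr V" "Dom V f = Dom V g" "Cod V f = Cod V g"
    and "f \<odot> Id V (unt V) = g \<odot> Id V (unt V)"
  shows "f = g"
proof (rule iso_cancel_right[of "run V (Dom V f)"])
  show "f \<cdot> run V (Dom V f) = g \<cdot> run V (Dom V f)"
    using run_natural[of f] run_natural[of g] assms by simp
qed (use assms in simp_all)

text \<open>Kelly's redundant coherence axiom: tensoring with the unit is faithful, and after tensoring
  the equation follows from the pentagon and the triangle.\<close>

lemma lun_tensor:
  assumes A: "A \<in> Obj V" and B: "B \<in> Obj V"
  shows "lun V (A \<boxtimes> B) \<cdot> asc V (unt V) A B = lun V A \<odot> Id V B"
proof -
  let ?I = "unt V"
  \<comment> \<open>This is the three-fold side of the pentagon at I, I, A, B without its leftmost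
    factor. It is invertible, so it can be cancelled once both sides composed with it have been
    brought to \<open>?r\<close>.\<close>
  let ?e = "asc V ?I (?I \<boxtimes> A) B \<cdot> (asc V ?I ?I A \<odot> Id V B)"
  let ?r = "asc V ?I A B \<cdot> ((run V ?I \<odot> Id V A) \<odot> Id V B)"
  have "(Id V ?I \<odot> (lun V (A \<boxtimes> B) \<cdot> asc V ?I A B)) \<cdot> ?e =
      (Id V ?I \<odot> lun V (A \<boxtimes> B)) \<cdot> (Id V ?I \<odot> asc V ?I A B) \<cdot> ?e"
    using A B by (simp add: interchange_tail)
  also have "\<dots> = (Id V ?I \<odot> lun V (A \<boxtimes> B)) \<cdot> asc V ?I ?I (A \<boxtimes> B) \<cdot> asc V (?I \<boxtimes> ?I) A B"
    using A B by (simp add: pentagon)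
  also have "\<dots> = (run V ?I \<odot> (Id V A \<odot> Id V B)) \<cdot> asc V (?I \<boxtimes> ?I) A B"
    using A B by (simp add: comp_cong_tail[OF triangle])
  also have "\<dots> = ?r"
    using A B asc_natural[of "run V ?I" "Id V A" "Id V B"] by simp
  finally have 1: "(Id V ?I \<odot> (lun V (A \<boxtimes> B) \<cdot> asc V ?I A B)) \<cdot> ?e = ?r" .
  have nat: "asc V ?I A B \<cdot> ((Id V ?I \<odot> lun V A) \<odot> Id V B) =
      (Id V ?I \<odot> (lun V A \<odot> Id V B)) \<cdot> asc V ?I (?I \<boxtimes> A) B"
    by (rule asc_nat[OF id_hom[OF unt_obj] lun_hom[OF A] id_hom[OF B]])
  have "(Id V ?I \<odot> (lun V A \<odot> Id V B)) \<cdot> ?e =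
      asc V ?I A B \<cdot> ((Id V ?I \<odot> lun V A) \<odot> Id V B) \<cdot> (asc V ?I ?I A \<odot> Id V B)"
    using A B comp_cong_tail[OF nat, of "asc V ?I ?I A \<odot> Id V B"] by simp
  also have "\<dots> = ?r"
    using A B by (simp add: interchange triangle)
  finally have 2: "(Id V ?I \<odot> (lun V A \<odot> Id V B)) \<cdot> ?e = ?r" .
  have "Id V ?I \<odot> (lun V (A \<boxtimes> B) \<cdot> asc V ?I A B) = Id V ?I \<odot> (lun V A \<odot> Id V B)"
  proof (rule iso_cancel_right[of ?e])
    show "invertible V ?e"
      using A B by (intro invertible_comp invertible_tensor_id) simp_all
  qed (use A B 1 2 in simp_all)
  then show ?thesis
    by (rule unt_tensor_faithful[rotated -1]) (use A B in simp_all)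
qed

text \<open>Both sides are tensored with the unit on the right and followed by a braiding; each
  operation reflects equality. The hexagon at A, I, I then connects them: \<open>lun_tensor\<close>
  is applied before and after it, naturality of \<open>lun\<close> and of the braiding moves the
  unit constraints into place, and the triangle yields \<open>run\<close>.\<close>

lemma lun_brd:
  assumes A: "A \<in> Obj V"
  shows "lun V A \<cdot> brd V A (unt V) = run V A"
proof -
  let ?I = "unt V"
  have lun_nat': "lun V (?I \<boxtimes> A) \<cdot> (Id V ?I \<odot> brd V A ?I) = brd V A ?I \<cdot> lun V (A \<boxtimes> ?I)"
    using A lun_natural[of "brd V A ?I"] by simp
  have brd_nat': "brd V A ?I \<cdot> (Id V A \<odot> lun V ?I) = (lun V ?I \<odot> Id V A) \<cdot> brd V A (?I \<boxtimes> ?I)"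
    using A brd_natural[of "Id V A" "lun V ?I"] by simp
  have "brd V A ?I \<cdot> ((lun V A \<cdot> brd V A ?I) \<odot> Id V ?I) =
      brd V A ?I \<cdot> (lun V A \<odot> Id V ?I) \<cdot> (brd V A ?I \<odot> Id V ?I)"
    using A by (simp add: interchange)
  also have "\<dots> = brd V A ?I \<cdot> lun V (A \<boxtimes> ?I) \<cdot> asc V ?I A ?I \<cdot> (brd V A ?I \<odot> Id V ?I)"
    using A by (simp add: comp_cong_tail[OF lun_tensor])
  also have "\<dots> = lun V (?I \<boxtimes> A) \<cdot> (Id V ?I \<odot> brd V A ?I) \<cdot> asc V ?I A ?I \<cdot> (brd V A ?I \<odot> Id V ?I)"
    using A by (simp add: comp_cong_tail[OF lun_nat'])
  also have "\<dots> = lun V (?I \<boxtimes> A) \<cdot> asc V ?I ?I A \<cdot> brd V A (?I \<boxtimes> ?I) \<cdot> asc V A ?I ?I"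
    using A by (simp add: hexagon)
  also have "\<dots> = (lun V ?I \<odot> Id V A) \<cdot> brd V A (?I \<boxtimes> ?I) \<cdot> asc V A ?I ?I"
    using A by (simp add: comp_cong_tail[OF lun_tensor])
  also have "\<dots> = brd V A ?I \<cdot> (Id V A \<odot> lun V ?I) \<cdot> asc V A ?I ?I"
    using A by (simp add: comp_cong_tail[OF brd_nat'])
  also have "\<dots> = brd V A ?I \<cdot> (run V A \<odot> Id V ?I)"
    using A by (simp add: triangle)
  finally have "brd V A ?I \<cdot> ((lun V A \<cdot> brd V A ?I) \<odot> Id V ?I) = brd V A ?I \<cdot> (run V A \<odot> Id V ?I)" .
  moreover have "invertible V (brd V A ?I)"
    using A by (auto simp: invertible_def brd_brd intro!: bexI[of _ "brd V ?I A"] HomI)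
  ultimately have "(lun V A \<cdot> brd V A ?I) \<odot> Id V ?I = run V A \<odot> Id V ?I"
    by (rule iso_cancel_left[of "brd V A ?I", rotated -1]) (use A in simp_all)
  then show ?thesis
    by (rule tensor_unt_faithful[rotated -1]) (use A in simp_all)
qed

lemma run_brd:
  assumes "A \<in> Obj V"
  shows "run V A \<cdot> brd V (unt V) A = lun V A"
  using assms by (simp add: brd_brd flip: lun_brd)

end


section \<open>Names of arrows\<close>

context smc_category
begin

lemma curry_arr:
  assumes "f \<in> Arr V" "Dom V f = D \<boxtimes> A" "Cod V f = B" "A \<in> Obj V" "B \<in> Obj V" "D \<in> Obj V"
  shows "curry_arr V D A B f \<in> Arr V" "Dom V (curry_arr V D A B f) = D"
    "Cod V (curry_arr V D A B f) = ihom V A B"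
    "ev V A B \<cdot> (curry_arr V D A B f \<odot> Id V A) = f"
proof -
  let ?P = "\<lambda>g. g \<in> Hom V D (ihom V A B) \<and> ev V A B \<cdot> (g \<odot> Id V A) = f"
  have "\<exists>!g. ?P g"
    using assms by (intro ev_universal HomI)
  then have "?P (curry_arr V D A B f)"
    unfolding curry_arr_def by (rule theI')
  then show "curry_arr V D A B f \<in> Arr V" "Dom V (curry_arr V D A B f) = D"
    "Cod V (curry_arr V D A B f) = ihom V A B"
    "ev V A B \<cdot> (curry_arr V D A B f \<odot> Id V A) = f"
    by (simp_all add: mem_Hom_iff)
qed

text \<open>The uniqueness half of the universal property of evaluation, and the means by which
  arrows into an internal hom are compared below.\<close>

lemma uncurry_inject:
  assumes "ev V A B \<cdot> (g \<odot> Id V A) = ev V A B \<cdot> (g' \<odot> Id V A)"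
    and "g \<in> Arr V" "g' \<in> Arr V" "Dom V g = Dom V g'"
    and "Cod V g = ihom V A B" "Cod V g' = ihom V A B" "A \<in> Obj V" "B \<in> Obj V"
  shows "g = g'"
proof -
  have "\<exists>!k. k \<in> Hom V (Dom V g) (ihom V A B) \<and> ev V A B \<cdot> (k \<odot> Id V A) = ev V A B \<cdot> (g \<odot> Id V A)"
    using assms(2-) by (intro ev_universal HomI) simp_all
  moreover have "g \<in> Hom V (Dom V g) (ihom V A B)" "g' \<in> Hom V (Dom V g) (ihom V A B)"
    using assms(2-) by (simp_all add: mem_Hom_iff)
  ultimately show ?thesis
    using assms(1) by auto
qed

text \<open>Evaluates a composite into an internal hom from the known evaluation \<open>f\<close> of
  its outer factor. The argument \<open>x\<close> is arbitrary, so the rule also applies where the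
  second factor is not an identity.\<close>

lemma ev_comp_left:
  assumes "ev V A B \<cdot> (g \<odot> Id V A) = f" and "g \<in> Arr V" "k \<in> Arr V"
    and "Dom V g = Cod V k" "Cod V g = ihom V A B" "A \<in> Obj V" "B \<in> Obj V" "x \<in> Arr V" "Cod V x = A"
  shows "ev V A B \<cdot> ((g \<cdot> k) \<odot> x) = f \<cdot> (k \<odot> x)"
proof -
  have "ev V A B \<cdot> ((g \<cdot> k) \<odot> x) = ev V A B \<cdot> (g \<odot> Id V A) \<cdot> (k \<odot> x)"
    using assms(2-) by (simp add: interchange)
  also have "\<dots> = f \<cdot> (k \<odot> x)"
    using assms(2-) by (intro comp_cong_tail assms(1)) simp_all
  finally show ?thesis .
qed

lemma name_arr:
  assumes "f \<in> Arr V"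
  shows "name_arr V f \<in> Arr V" "Dom V (name_arr V f) = unt V"
    "Cod V (name_arr V f) = ihom V (Dom V f) (Cod V f)"
    "ev V (Dom V f) (Cod V f) \<cdot> (name_arr V f \<odot> Id V (Dom V f)) = f \<cdot> lun V (Dom V f)"
  unfolding name_arr_def using assms by (simp_all add: curry_arr)

lemma name_arr_hom: "f \<in> Hom V A B \<Longrightarrow> name_arr V f \<in> Hom V (unt V) (ihom V A B)"
  using name_arr[of f] by (simp add: mem_Hom_iff)

lemma name_arr_inject:
  assumes "name_arr V f = name_arr V g" "f \<in> Arr V" "g \<in> Arr V" "Dom V f = Dom V g" "Cod V f = Cod V g"
  shows "f = g"
proof (rule iso_cancel_right[of "lun V (Dom V f)"])
  show "f \<cdot> lun V (Dom V f) = g \<cdot> lun V (Dom V f)"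
    using name_arr(4)[of f] name_arr(4)[of g] assms by simp
qed (use assms in simp_all)

lemma name_arr_eqI:
  assumes "ev V A B \<cdot> (e \<odot> Id V A) = f \<cdot> lun V A"
    and "e \<in> Hom V (unt V) (ihom V A B)" "f \<in> Hom V A B"
  shows "e = name_arr V f"
  using HomD[OF assms(2)] HomD[OF assms(3)] name_arr[of f]
  by (intro uncurry_inject[of A B e "name_arr V f"]) (simp_all add: assms(1))

lemma unname_arr:
  assumes "e \<in> Hom V (unt V) (ihom V A B)" "A \<in> Obj V" "B \<in> Obj V"
  shows "unname_arr V A B e \<in> Hom V A B" "name_arr V (unname_arr V A B e) = e"
proof -
  show *: "unname_arr V A B e \<in> Hom V A B"
    using assms HomD[OF assms(1)] by (simp add: unname_arr_def uncurry_arr_def mem_Hom_iff)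
  show "name_arr V (unname_arr V A B e) = e"
  proof (rule name_arr_eqI[symmetric])
    show "ev V A B \<cdot> (e \<odot> Id V A) = unname_arr V A B e \<cdot> lun V A"
      using assms HomD[OF assms(1)]
      by (simp add: unname_arr_def uncurry_arr_def inverse_arr(2))
  qed (use assms * in simp_all)
qed

section \<open>Composition in \<open>self V\<close>, read through evaluation\<close>

lemma ecomp_self:
  assumes "A \<in> Obj V" "B \<in> Obj V" "D \<in> Obj V"
  shows "ecomp (self V) A B D \<in> Arr V"
    "Dom V (ecomp (self V) A B D) = ihom V B D \<boxtimes> ihom V A B"
    "Cod V (ecomp (self V) A B D) = ihom V A D"
    "ev V A D \<cdot> (ecomp (self V) A B D \<odot> Id V A) =
      ev V B D \<cdot> (Id V (ihom V B D) \<odot> ev V A B) \<cdot> asc V (ihom V B D) (ihom V A B) A"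
  using assms by (simp_all add: self_def curry_arr)

text \<open>For generalized elements \<open>g\<close> and \<open>f\<close>, evaluating the internal
  composite means evaluating \<open>f\<close> and then \<open>g\<close>; naturality of the
  associator moves the elements past the rebracketing.\<close>

lemma ev_ecomp_self:
  assumes "g \<in> Hom V P (ihom V B D)" "f \<in> Hom V Q (ihom V A B)" "A \<in> Obj V" "B \<in> Obj V" "D \<in> Obj V"
  shows "ev V A D \<cdot> ((ecomp (self V) A B D \<cdot> (g \<odot> f)) \<odot> Id V A) =
    ev V B D \<cdot> (g \<odot> (ev V A B \<cdot> (f \<odot> Id V A))) \<cdot> asc V P Q A"
proof -
  have nat: "asc V (ihom V B D) (ihom V A B) A \<cdot> ((g \<odot> f) \<odot> Id V A) =
      (g \<odot> (f \<odot> Id V A)) \<cdot> asc V P Q A"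
    using assms by (intro asc_nat id_hom)
  note simps = HomD[OF assms(1)] HomD[OF assms(2)] assms(3-) ecomp_self[of A B D]
  have "ev V A D \<cdot> ((ecomp (self V) A B D \<cdot> (g \<odot> f)) \<odot> Id V A) =
      (ev V B D \<cdot> (Id V (ihom V B D) \<odot> ev V A B) \<cdot> asc V (ihom V B D) (ihom V A B) A) \<cdot>
      ((g \<odot> f) \<odot> Id V A)"
    using simps by (intro ev_comp_left) simp_all
  also have "\<dots> = ev V B D \<cdot> (Id V (ihom V B D) \<odot> ev V A B) \<cdot> (g \<odot> (f \<odot> Id V A)) \<cdot> asc V P Q A"
    using simps by (simp add: nat)
  also have "\<dots> = ev V B D \<cdot> (g \<odot> (ev V A B \<cdot> (f \<odot> Id V A))) \<cdot> asc V P Q A"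
    using simps by (simp add: interchange_tail)
  finally show ?thesis .
qed

text \<open>The definitions of \<open>elcomp\<close> and \<open>enriched_natural\<close> insert an
  inverse unit constraint. After evaluation it meets an associator, and \<open>lun_tensor\<close>
  makes both disappear. For \<open>run\<close> in the next lemma the triangle axiom
  suffices.\<close>

lemma asc_inverse_lun:
  assumes "A \<in> Obj V" "B \<in> Obj V"
  shows "lun V (A \<boxtimes> B) \<cdot> asc V (unt V) A B \<cdot> (inverse_arr V (lun V A) \<odot> Id V B) = Id V (A \<boxtimes> B)"
  using assms by (simp add: comp_cong_tail[OF lun_tensor] interchange inverse_arr)

lemma asc_inverse_run:
  assumes "A \<in> Obj V" "B \<in> Obj V"
  shows "(Id V A \<odot> lun V B) \<cdot> asc V A (unt V) B \<cdot> (inverse_arr V (run V A) \<odot> Id V B) = Id V (A \<boxtimes> B)"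
  using assms by (simp add: comp_cong_tail[OF triangle] interchange inverse_arr)

text \<open>One leg of an enriched naturality square: composing with the name of \<open>f\<close> in
  the left slot becomes, after evaluation, ordinary composition with \<open>f\<close>.\<close>

lemma ev_postcompose:
  assumes f: "f \<in> Hom V B D" and g: "g \<in> Hom V P (ihom V A B)" and A: "A \<in> Obj V"
  shows "ev V A D \<cdot> ((ecomp (self V) A B D \<cdot> (name_arr V f \<odot> g) \<cdot> inverse_arr V (lun V P)) \<odot> Id V A) =
    f \<cdot> ev V A B \<cdot> (g \<odot> Id V A)"
proof -
  note simps = HomD[OF f] HomD[OF g] A ecomp_self[of A B D] name_arr(1-3)[of f]
  let ?k = "inverse_arr V (lun V P) \<odot> Id V A"
  let ?u = "ev V A B \<cdot> (g \<odot> Id V A)"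
  have name: "ev V B D \<cdot> (name_arr V f \<odot> ?u) = f \<cdot> lun V B \<cdot> (Id V (unt V) \<odot> ?u)"
    using simps ev_comp_left[OF name_arr(4)[of f], of "Id V (unt V)" ?u] by simp
  have nat: "lun V B \<cdot> (Id V (unt V) \<odot> ?u) = ?u \<cdot> lun V (P \<boxtimes> A)"
    using simps by (intro lun_nat HomI) simp_all
  have "ev V A D \<cdot> ((ecomp (self V) A B D \<cdot> (name_arr V f \<odot> g) \<cdot> inverse_arr V (lun V P)) \<odot> Id V A) =
      (ev V A D \<cdot> ((ecomp (self V) A B D \<cdot> (name_arr V f \<odot> g)) \<odot> Id V A)) \<cdot> ?k"
    using simps by (simp add: interchange)
  also have "\<dots> = (ev V B D \<cdot> (name_arr V f \<odot> ?u) \<cdot> asc V (unt V) P A) \<cdot> ?k"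
    using simps by (simp only: ev_ecomp_self[OF name_arr_hom[OF f] g])
  also have "\<dots> = ev V B D \<cdot> (name_arr V f \<odot> ?u) \<cdot> asc V (unt V) P A \<cdot> ?k"
    using simps by simp
  also have "\<dots> = f \<cdot> lun V B \<cdot> (Id V (unt V) \<odot> ?u) \<cdot> asc V (unt V) P A \<cdot> ?k"
    using simps comp_cong_tail[OF name, of "asc V (unt V) P A \<cdot> ?k"] by simp
  also have "\<dots> = f \<cdot> ?u \<cdot> lun V (P \<boxtimes> A) \<cdot> asc V (unt V) P A \<cdot> ?k"
    using simps comp_cong_tail[OF nat, of "asc V (unt V) P A \<cdot> ?k"] by simp
  also have "\<dots> = f \<cdot> ?u"
    using simps by (simp add: asc_inverse_lun)
  finally show ?thesis .
qed

text \<open>The other leg of the square: the name of \<open>f\<close> in the right slot becomes the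
  insertion of \<open>f\<close> into the argument of evaluation.\<close>

lemma ev_precompose:
  assumes f: "f \<in> Hom V A B" and g: "g \<in> Hom V P (ihom V B D)" and D: "D \<in> Obj V"
  shows "ev V A D \<cdot> ((ecomp (self V) A B D \<cdot> (g \<odot> name_arr V f) \<cdot> inverse_arr V (run V P)) \<odot> Id V A) =
    ev V B D \<cdot> (g \<odot> f)"
proof -
  note simps = HomD[OF f] HomD[OF g] D ecomp_self[of A B D] name_arr[of f]
  let ?k = "inverse_arr V (run V P) \<odot> Id V A"
  have "ev V A D \<cdot> ((ecomp (self V) A B D \<cdot> (g \<odot> name_arr V f) \<cdot> inverse_arr V (run V P)) \<odot> Id V A) =
      (ev V A D \<cdot> ((ecomp (self V) A B D \<cdot> (g \<odot> name_arr V f)) \<odot> Id V A)) \<cdot> ?k"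
    using simps by (simp add: interchange)
  also have "\<dots> = (ev V B D \<cdot> (g \<odot> (f \<cdot> lun V A)) \<cdot> asc V P (unt V) A) \<cdot> ?k"
    using simps by (simp only: ev_ecomp_self[OF g name_arr_hom[OF f]])
  also have "\<dots> = ev V B D \<cdot> (g \<odot> f) \<cdot> (Id V P \<odot> lun V A) \<cdot> asc V P (unt V) A \<cdot> ?k"
    using simps by (simp add: interchange_tail)
  also have "\<dots> = ev V B D \<cdot> (g \<odot> f)"
    using simps by (simp add: asc_inverse_run)
  finally show ?thesis .
qed

lemma elcomp_name_arr:
  assumes f: "f \<in> Hom V A B" and g: "g \<in> Hom V B D"
  shows "elcomp V (self V) A B D (name_arr V g) (name_arr V f) = name_arr V (g \<cdot> f)"
proof (rule name_arr_eqI)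
  note simps = HomD[OF f] HomD[OF g] ecomp_self[of A B D] name_arr[of f] name_arr[of g]
  show "ev V A D \<cdot> (elcomp V (self V) A B D (name_arr V g) (name_arr V f) \<odot> Id V A) = (g \<cdot> f) \<cdot> lun V A"
    unfolding elcomp_def using simps by (simp add: ev_postcompose[OF g name_arr_hom[OF f]])
  show "elcomp V (self V) A B D (name_arr V g) (name_arr V f) \<in> Hom V (unt V) (ihom V A D)"
    unfolding elcomp_def using simps by (simp add: mem_Hom_iff)
  show "g \<cdot> f \<in> Hom V A D"
    using simps by (simp add: mem_Hom_iff)
qed

lemma eid_self: "A \<in> Obj V \<Longrightarrow> eid (self V) A = name_arr V (Id V A)"
  by (simp add: self_def name_arr_def)

lemma self_simps [simp]: "eobj (self V) = Obj V" "ehom (self V) = ihom V"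
  by (simp_all add: self_def)

text \<open>Ordinary naturality is the enriched square evaluated at one element \<open>e\<close> of
  the hom-object. The arrows \<open>u\<close> and \<open>v\<close> that the two functors assign to
  \<open>e\<close> are parameters, so the domain category \<open>B\<close> need not be a
  self-enrichment; below it is also the category of algebras. The hom-actions are typed by
  assumptions because \<open>enriched_natural\<close> says nothing about functoriality.\<close>

lemma enriched_natural_imp_natural:
  assumes nat: "enriched_natural V B (self V) F G (\<lambda>x. name_arr V (\<tau> x))"
    and a: "a \<in> eobj B" and b: "b \<in> eobj B"
    and tau_a: "\<tau> a \<in> Hom V (fobj F a) (fobj G a)" and tau_b: "\<tau> b \<in> Hom V (fobj F b) (fobj G b)"
    and F_hom: "fhom F a b \<in> Hom V (ehom B a b) (ihom V (fobj F a) (fobj F b))"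
    and G_hom: "fhom G a b \<in> Hom V (ehom B a b) (ihom V (fobj G a) (fobj G b))"
    and e: "e \<in> Hom V (unt V) (ehom B a b)"
    and u: "fhom F a b \<cdot> e = name_arr V u" "u \<in> Hom V (fobj F a) (fobj F b)"
    and v: "fhom G a b \<cdot> e = name_arr V v" "v \<in> Hom V (fobj G a) (fobj G b)"
  shows "\<tau> b \<cdot> u = v \<cdot> \<tau> a"
proof -
  let ?A = "fobj F a" and ?B = "fobj F b" and ?A' = "fobj G a" and ?B' = "fobj G b" and ?P = "ehom B a b"
  note simps = HomD[OF tau_a] HomD[OF tau_b] HomD[OF F_hom] HomD[OF G_hom] HomD[OF e]
    HomD[OF u(2)] HomD[OF v(2)]
  have eq: "ecomp (self V) ?A ?B ?B' \<cdot> (name_arr V (\<tau> b) \<odot> fhom F a b) \<cdot> inverse_arr V (lun V ?P) =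
      ecomp (self V) ?A ?A' ?B' \<cdot> (fhom G a b \<odot> name_arr V (\<tau> a)) \<cdot> inverse_arr V (run V ?P)"
    using nat a b by (simp add: enriched_natural_def)
  have "\<tau> b \<cdot> ev V ?A ?B \<cdot> (fhom F a b \<odot> Id V ?A) = ev V ?A' ?B' \<cdot> (fhom G a b \<odot> \<tau> a)"
    using ev_postcompose[OF tau_b F_hom] ev_precompose[OF tau_a G_hom] eq simps by simp
  \<comment> \<open>Restricting along \<open>e\<close> replaces the two hom-actions by the names of
    \<open>u\<close> and \<open>v\<close>. Both sides then end in the same unit constraint, which is
    cancelled.\<close>
  then have "(\<tau> b \<cdot> ev V ?A ?B \<cdot> (fhom F a b \<odot> Id V ?A)) \<cdot> (e \<odot> Id V ?A) =
      (ev V ?A' ?B' \<cdot> (fhom G a b \<odot> \<tau> a)) \<cdot> (e \<odot> Id V ?A)"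
    by simp
  then have "\<tau> b \<cdot> ev V ?A ?B \<cdot> (name_arr V u \<odot> Id V ?A) = ev V ?A' ?B' \<cdot> (name_arr V v \<odot> \<tau> a)"
    using simps by (simp add: interchange u(1) v(1))
  moreover have "ev V ?A ?B \<cdot> (name_arr V u \<odot> Id V ?A) = u \<cdot> lun V ?A"
    using name_arr(4)[of u] simps by simp
  moreover have "ev V ?A' ?B' \<cdot> (name_arr V v \<odot> \<tau> a) = v \<cdot> lun V ?A' \<cdot> (Id V (unt V) \<odot> \<tau> a)"
    using simps name_arr(1-3)[of v] ev_comp_left[OF name_arr(4)[of v], of "Id V (unt V)" "\<tau> a"] by simp
  moreover have "lun V ?A' \<cdot> (Id V (unt V) \<odot> \<tau> a) = \<tau> a \<cdot> lun V ?A"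
    using tau_a by (rule lun_nat)
  ultimately have "(\<tau> b \<cdot> u) \<cdot> lun V ?A = (v \<cdot> \<tau> a) \<cdot> lun V ?A"
    using simps by simp
  then show ?thesis
    by (rule iso_cancel_right[rotated -1]) (use simps in simp_all)
qed

end


section \<open>Double dualization\<close>

context smc_category
begin

lemma precomp:
  assumes f: "f \<in> Hom V A A'" and B: "B \<in> Obj V"
  shows "precomp V f B \<in> Hom V (ihom V A' B) (ihom V A B)"
    and "ev V A B \<cdot> (precomp V f B \<odot> Id V A) = ev V A' B \<cdot> (Id V (ihom V A' B) \<odot> f)"
  using HomD[OF f] B by (simp_all add: precomp_def mem_Hom_iff curry_arr)

lemma precomp_eqI:
  assumes "ev V A B \<cdot> (k \<odot> Id V A) = ev V A' B \<cdot> (Id V (ihom V A' B) \<odot> f)"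
    and f: "f \<in> Hom V A A'" and k: "k \<in> Hom V (ihom V A' B) (ihom V A B)" and B: "B \<in> Obj V"
  shows "k = precomp V f B"
  using HomD[OF f] HomD[OF k] HomD[OF precomp(1)[OF f B]] precomp(2)[OF f B] assms(1) B
  by (intro uncurry_inject[of A B k "precomp V f B"]) simp_all

lemma precomp_id: "\<lbrakk>A \<in> Obj V; B \<in> Obj V\<rbrakk> \<Longrightarrow> precomp V (Id V A) B = Id V (ihom V A B)"
  by (rule precomp_eqI[symmetric]) (simp_all add: mem_Hom_iff)

lemma precomp_comp:
  assumes f: "f \<in> Hom V A A'" and g: "g \<in> Hom V A' A''" and B: "B \<in> Obj V"
  shows "precomp V f B \<cdot> precomp V g B = precomp V (g \<cdot> f) B"
proof (rule precomp_eqI)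
  note simps = HomD[OF f] HomD[OF g] HomD[OF precomp(1)[OF f B]] HomD[OF precomp(1)[OF g B]] B
  have "ev V A B \<cdot> ((precomp V f B \<cdot> precomp V g B) \<odot> Id V A) =
      (ev V A' B \<cdot> (Id V (ihom V A' B) \<odot> f)) \<cdot> (precomp V g B \<odot> Id V A)"
    using simps by (intro ev_comp_left precomp[OF f B]) simp_all
  also have "\<dots> = ev V A' B \<cdot> (precomp V g B \<odot> Id V A') \<cdot> (Id V (ihom V A'' B) \<odot> f)"
    using simps by (simp add: interchange)
  also have "\<dots> = (ev V A'' B \<cdot> (Id V (ihom V A'' B) \<odot> g)) \<cdot> (Id V (ihom V A'' B) \<odot> f)"
    using simps by (intro comp_cong_tail precomp[OF g B]) simp_all
  also have "\<dots> = ev V A'' B \<cdot> (Id V (ihom V A'' B) \<odot> (g \<cdot> f))"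
    using simps by (simp add: interchange)
  finally show "ev V A B \<cdot> ((precomp V f B \<cdot> precomp V g B) \<odot> Id V A) =
      ev V A'' B \<cdot> (Id V (ihom V A'' B) \<odot> (g \<cdot> f))" .
  show "g \<cdot> f \<in> Hom V A A''" "precomp V f B \<cdot> precomp V g B \<in> Hom V (ihom V A'' B) (ihom V A B)"
    using simps by (simp_all add: mem_Hom_iff)
qed (fact B)

lemma dual_hom_hom:
  assumes "R \<in> Obj V" "E \<in> Obj V" "E' \<in> Obj V"
  shows "dual_hom V R E E' \<in> Hom V (ihom V E E') (ihom V (ihom V E' R) (ihom V E R))"
  using assms by (simp add: dual_hom_def mem_Hom_iff curry_arr ecomp_self)

text \<open>On ordinary arrows the enriched dualization functor is precomposition. The braiding
  built into \<open>dual_hom\<close> turns into a unit braiding at the name of \<open>f\<close>, and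
  \<open>run_brd\<close> absorbs it.\<close>

lemma dual_hom_name_arr:
  assumes R: "R \<in> Obj V" and f: "f \<in> Hom V E E'"
  shows "dual_hom V R E E' \<cdot> name_arr V f = name_arr V (precomp V f R)"
proof (rule name_arr_eqI)
  let ?D = "ihom V E R" and ?D' = "ihom V E' R"
  note simps = HomD[OF f] R ecomp_self[of E E' R] HomD[OF precomp(1)[OF f R]]
    HomD[OF name_arr_hom[OF f]] HomD[OF dual_hom_hom[OF R, of E E']]
  let ?c = "ecomp (self V) E E' R \<cdot> (Id V ?D' \<odot> name_arr V f)"
  have dual: "ev V ?D' ?D \<cdot> (dual_hom V R E E' \<odot> Id V ?D') =
      ecomp (self V) E E' R \<cdot> brd V (ihom V E E') ?D'"
    using simps by (simp add: dual_hom_def curry_arr)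
  have nat: "brd V (ihom V E E') ?D' \<cdot> (name_arr V f \<odot> Id V ?D') =
      (Id V ?D' \<odot> name_arr V f) \<cdot> brd V (unt V) ?D'"
    using simps by (intro brd_nat name_arr_hom[OF f] id_hom) simp_all
  have precomp: "?c \<cdot> inverse_arr V (run V ?D') = precomp V f R"
  proof (rule precomp_eqI)
    show "ev V E R \<cdot> ((?c \<cdot> inverse_arr V (run V ?D')) \<odot> Id V E) = ev V E' R \<cdot> (Id V ?D' \<odot> f)"
      using simps ev_precompose[OF f id_hom[of "ihom V E' R"] R] by simp
    show "?c \<cdot> inverse_arr V (run V ?D') \<in> Hom V ?D' ?D"
      using simps by (simp add: mem_Hom_iff)
  qed (fact f R)+
  have "ev V ?D' ?D \<cdot> ((dual_hom V R E E' \<cdot> name_arr V f) \<odot> Id V ?D') =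
      (ecomp (self V) E E' R \<cdot> brd V (ihom V E E') ?D') \<cdot> (name_arr V f \<odot> Id V ?D')"
    using simps by (intro ev_comp_left dual) simp_all
  also have "\<dots> = ?c \<cdot> brd V (unt V) ?D'"
    using simps by (simp add: nat)
  also have "\<dots> = ?c \<cdot> inverse_arr V (run V ?D') \<cdot> run V ?D' \<cdot> brd V (unt V) ?D'"
    using simps by (simp add: comp_cong_tail[OF inverse_arr(2)])
  also have "\<dots> = (?c \<cdot> inverse_arr V (run V ?D')) \<cdot> lun V ?D'"
    using simps by (simp add: run_brd)
  also have "\<dots> = precomp V f R \<cdot> lun V ?D'"
    by (simp only: precomp)
  finally show "ev V ?D' ?D \<cdot> ((dual_hom V R E E' \<cdot> name_arr V f) \<odot> Id V ?D') =
      precomp V f R \<cdot> lun V ?D'" .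
  show "dual_hom V R E E' \<cdot> name_arr V f \<in> Hom V (unt V) (ihom V ?D' ?D)"
    using simps by (simp add: mem_Hom_iff)
qed (fact precomp(1)[OF f R])

lemma dd_unit:
  assumes "R \<in> Obj V" "E \<in> Obj V"
  shows "dd_unit V R E \<in> Hom V E (ihom V (ihom V E R) R)"
    and "ev V (ihom V E R) R \<cdot> (dd_unit V R E \<odot> Id V (ihom V E R)) = ev V E R \<cdot> brd V E (ihom V E R)"
  using assms by (simp_all add: dd_unit_def mem_Hom_iff curry_arr)

text \<open>A triangle identity of the self-adjunction of [-,R]. Under evaluation each of the two
  units contributes one braiding, and the braidings cancel by symmetry.\<close>

lemma dd_triangle:
  assumes R: "R \<in> Obj V" and E: "E \<in> Obj V"
  shows "precomp V (dd_unit V R E) R \<cdot> dd_unit V R (ihom V E R) = Id V (ihom V E R)"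
proof (rule uncurry_inject)
  let ?D = "ihom V E R"
  let ?DD = "ihom V ?D R"
  let ?d = "dd_unit V R E" and ?d' = "dd_unit V R ?D"
  have d: "?d \<in> Hom V E ?DD" and d': "?d' \<in> Hom V ?D (ihom V ?DD R)"
    using R E by (simp_all add: dd_unit(1))
  note simps = HomD[OF d] HomD[OF d'] R HomD[OF precomp(1)[OF d R]]
  have nat: "brd V ?D ?DD \<cdot> (Id V ?D \<odot> ?d) = (?d \<odot> Id V ?D) \<cdot> brd V ?D E"
    using simps by (intro brd_nat d id_hom) simp_all
  have "ev V E R \<cdot> ((precomp V ?d R \<cdot> ?d') \<odot> Id V E) =
      (ev V ?DD R \<cdot> (Id V (ihom V ?DD R) \<odot> ?d)) \<cdot> (?d' \<odot> Id V E)"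
    using simps by (intro ev_comp_left precomp[OF d R]) simp_all
  also have "\<dots> = ev V ?DD R \<cdot> (?d' \<odot> Id V ?DD) \<cdot> (Id V ?D \<odot> ?d)"
    using simps by (simp add: interchange)
  also have "\<dots> = (ev V ?D R \<cdot> brd V ?D ?DD) \<cdot> (Id V ?D \<odot> ?d)"
    using simps by (intro comp_cong_tail dd_unit) simp_all
  also have "\<dots> = ev V ?D R \<cdot> (?d \<odot> Id V ?D) \<cdot> brd V ?D E"
    using simps by (simp add: nat)
  also have "\<dots> = (ev V E R \<cdot> brd V E ?D) \<cdot> brd V ?D E"
    using simps by (intro comp_cong_tail dd_unit) simp_all
  also have "\<dots> = ev V E R \<cdot> (Id V ?D \<odot> Id V E)"
    using simps by (simp add: brd_brd)
  finally show "ev V E R \<cdot> ((precomp V ?d R \<cdot> ?d') \<odot> Id V E) = ev V E R \<cdot> (Id V ?D \<odot> Id V E)" .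
  show "precomp V ?d R \<cdot> ?d' \<in> Arr V" "Id V ?D \<in> Arr V" "E \<in> Obj V" "R \<in> Obj V"
    "Dom V (precomp V ?d R \<cdot> ?d') = Dom V (Id V ?D)"
    "Cod V (precomp V ?d R \<cdot> ?d') = ?D" "Cod V (Id V ?D) = ?D"
    using simps by simp_all
qed

lemma dd_fhom_name_arr:
  assumes R: "R \<in> Obj V" and f: "f \<in> Hom V E E'"
  shows "fhom (dd_monad V R) E E' \<cdot> name_arr V f = name_arr V (precomp V (precomp V f R) R)"
  using HomD[OF f] HomD[OF name_arr_hom[OF f]] R
    HomD[OF dual_hom_hom[OF R, of E E']] HomD[OF dual_hom_hom[OF R, of "ihom V E' R" "ihom V E R"]]
    dual_hom_name_arr[OF R f] dual_hom_name_arr[OF R precomp(1)[OF f R]]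
  by (simp add: dd_monad_def)

lemma dd_fhom_hom:
  assumes R: "R \<in> Obj V" and "E \<in> Obj V" "E' \<in> Obj V"
  shows "fhom (dd_monad V R) E E' \<in>
    Hom V (ihom V E E') (ihom V (fobj (dd_monad V R) E) (fobj (dd_monad V R) E'))"
  using assms HomD[OF dual_hom_hom[OF R, of E E']] HomD[OF dual_hom_hom[OF R, of "ihom V E' R" "ihom V E R"]]
  by (simp add: dd_monad_def mem_Hom_iff)

lemma dd_mmult_hom:
  assumes "R \<in> Obj V" "E \<in> Obj V"
  shows "mmult (dd_monad V R) E \<in>
    Hom V (fobj (dd_monad V R) (fobj (dd_monad V R) E)) (fobj (dd_monad V R) E)"
  using assms by (simp add: dd_monad_def precomp dd_unit)

text \<open>This is k \<cdot> Hd = 1, the dual of \<open>dd_triangle\<close>: contravariance of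
  precomposition merges the two factors into the dual of an identity.\<close>

lemma dd_mmult_unit:
  assumes R: "R \<in> Obj V" and E: "E \<in> Obj V"
  shows "mmult (dd_monad V R) E \<cdot> precomp V (precomp V (munit (dd_monad V R) E) R) R =
    Id V (fobj (dd_monad V R) E)"
proof -
  have "precomp V (dd_unit V R (ihom V E R)) R \<cdot> precomp V (precomp V (dd_unit V R E) R) R =
      precomp V (precomp V (dd_unit V R E) R \<cdot> dd_unit V R (ihom V E R)) R"
    using precomp_comp[OF dd_unit(1) precomp(1)[OF dd_unit(1)]] R E by simp
  then show ?thesis
    using R E by (simp add: dd_monad_def dd_triangle precomp_id)
qed

lemma comp_functor_simps [simp]:
  "fobj (comp_functor V F G) a = fobj F (fobj G a)"
  "fhom (comp_functor V F G) a b = fhom F (fobj G a) (fobj G b) \<cdot> fhom G a b"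
  by (simp_all add: comp_functor_def)

lemma elements_simps [simp]:
  "fobj (elements V T) = fobj T" "fhom (elements V T) = fhom T"
  "munit (elements V T) a = name_arr V (munit T a)" "mmult (elements V T) a = name_arr V (mmult T a)"
  by (simp_all add: elements_def)

end

section \<open>Monads\<close>

text \<open>Extracts the ordinary monad on V from an enriched one. It is instantiated twice, with
  \<open>L\<close> for the algebras that form the linear spaces and with \<open>M\<close> for the
  monad of the conclusion.\<close>

locale monad_on_self = smc_category V
  for V :: "('o, 'a, 'r) smc_category_scheme" (structure) +
  fixes T :: "('o, 'a) emonad"
  assumes self_monad: "self_monad V T"
begin

lemma munit_hom: "A \<in> Obj V \<Longrightarrow> munit T A \<in> Hom V A (fobj T A)"
  and mmult_hom: "A \<in> Obj V \<Longrightarrow> mmult T A \<in> Hom V (fobj T (fobj T A)) (fobj T A)"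
  using self_monad by (auto simp: self_monad_def)

lemma fobj_obj [simp]: "A \<in> Obj V \<Longrightarrow> fobj T A \<in> Obj V"
  using munit_hom HomD by blast

lemma endofunctor: "enriched_functor V (self V) (self V) (elements V T)"
  using self_monad by (simp add: self_monad_def enriched_monad_def)

lemma fhom_hom: "\<lbrakk>A \<in> Obj V; B \<in> Obj V\<rbrakk> \<Longrightarrow> fhom T A B \<in> Hom V (ihom V A B) (ihom V (fobj T A) (fobj T B))"
  using endofunctor by (simp add: enriched_functor_def)

lemma arr_map:
  assumes f: "f \<in> Hom V A B"
  shows "arr_map V T f \<in> Hom V (fobj T A) (fobj T B)"
    and "fhom T A B \<cdot> name_arr V f = name_arr V (arr_map V T f)"
proof -
  have "fhom T A B \<cdot> name_arr V f \<in> Hom V (unt V) (ihom V (fobj T A) (fobj T B))"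
    using HomD[OF f] by (intro comp_hom[OF fhom_hom name_arr_hom[OF f]])
  then show "arr_map V T f \<in> Hom V (fobj T A) (fobj T B)"
    and "fhom T A B \<cdot> name_arr V f = name_arr V (arr_map V T f)"
    using HomD[OF f] by (simp_all add: arr_map_def unname_arr)
qed

text \<open>Enriched functoriality applied to the names of \<open>g\<close> and \<open>f\<close>;
  \<open>elcomp_name_arr\<close> translates composition of names into composition of arrows on both
  sides.\<close>

lemma arr_map_comp:
  assumes f: "f \<in> Hom V A B" and g: "g \<in> Hom V B D"
  shows "arr_map V T (g \<cdot> f) = arr_map V T g \<cdot> arr_map V T f"
proof -
  note simps = HomD[OF f] HomD[OF g] HomD[OF name_arr_hom[OF f]] HomD[OF name_arr_hom[OF g]]
    HomD[OF fhom_hom[of A B]] HomD[OF fhom_hom[of B D]] HomD[OF fhom_hom[of A D]]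
    HomD[OF arr_map(1)[OF f]] HomD[OF arr_map(1)[OF g]]
  note gf = comp_hom[OF g f]
  have functorial: "fhom T A D \<cdot> ecomp (self V) A B D =
      ecomp (self V) (fobj T A) (fobj T B) (fobj T D) \<cdot> (fhom T B D \<odot> fhom T A B)"
    using endofunctor simps by (simp add: enriched_functor_def)
  have "name_arr V (arr_map V T (g \<cdot> f)) =
      fhom T A D \<cdot> elcomp V (self V) A B D (name_arr V g) (name_arr V f)"
    using f g by (simp add: arr_map(2)[OF gf] elcomp_name_arr)
  also have "\<dots> = elcomp V (self V) (fobj T A) (fobj T B) (fobj T D)
      (fhom T B D \<cdot> name_arr V g) (fhom T A B \<cdot> name_arr V f)"
    using simps ecomp_self[of A B D] ecomp_self[of "fobj T A" "fobj T B" "fobj T D"]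
    by (simp add: elcomp_def comp_cong_tail[OF functorial] interchange_tail)
  also have "\<dots> = name_arr V (arr_map V T g \<cdot> arr_map V T f)"
    using arr_map[OF f] arr_map[OF g] by (simp add: elcomp_name_arr)
  finally show ?thesis
    by (rule name_arr_inject) (use simps HomD[OF gf] HomD[OF arr_map(1)[OF gf]] in simp_all)
qed

lemma munit_natural:
  assumes f: "f \<in> Hom V A B"
  shows "munit T B \<cdot> f = arr_map V T f \<cdot> munit T A"
proof (rule enriched_natural_imp_natural[where B = "self V" and F = "id_functor V (self V)" and G = T
      and \<tau> = "munit T" and a = A and b = B and e = "name_arr V f"])
  note simps = HomD[OF f]
  show "enriched_natural V (self V) (self V) (id_functor V (self V)) T (\<lambda>x. name_arr V (munit T x))"
    using self_monad by (simp add: self_monad_def enriched_monad_def enriched_natural_def)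
  show "fhom T A B \<cdot> name_arr V f = name_arr V (arr_map V T f)"
    by (rule arr_map(2)[OF f])
  show "fhom (id_functor V (self V)) A B \<cdot> name_arr V f = name_arr V f"
    using simps name_arr[of f] by (simp add: id_functor_def)
qed (use HomD[OF f] f in \<open>simp_all add: munit_hom arr_map fhom_hom name_arr_hom id_functor_def id_hom\<close>)

lemma mmult_natural:
  assumes f: "f \<in> Hom V A B"
  shows "mmult T B \<cdot> arr_map V T (arr_map V T f) = arr_map V T f \<cdot> mmult T A"
proof (rule enriched_natural_imp_natural[where B = "self V" and G = T
      and F = "comp_functor V (elements V T) (elements V T)"
      and \<tau> = "mmult T" and a = A and b = B and e = "name_arr V f"])
  note simps = HomD[OF f] HomD[OF fhom_hom[of A B]] HomD[OF fhom_hom[of "fobj T A" "fobj T B"]]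
    HomD[OF name_arr_hom[OF f]]
  show "enriched_natural V (self V) (self V) (comp_functor V (elements V T) (elements V T)) T
      (\<lambda>x. name_arr V (mmult T x))"
    using self_monad by (simp add: self_monad_def enriched_monad_def enriched_natural_def)
  show "fhom T A B \<cdot> name_arr V f = name_arr V (arr_map V T f)"
    by (rule arr_map(2)[OF f])
  show "fhom (comp_functor V (elements V T) (elements V T)) A B \<cdot> name_arr V f =
      name_arr V (arr_map V T (arr_map V T f))"
    using simps by (simp add: arr_map(2)[OF f] arr_map(2)[OF arr_map(1)[OF f]])
  show "arr_map V T (arr_map V T f) \<in> Hom V (fobj (comp_functor V (elements V T) (elements V T)) A)
      (fobj (comp_functor V (elements V T) (elements V T)) B)"
    using f by (simp add: arr_map)
qed (use HomD[OF f] f in \<open>simp_all add: mmult_hom arr_map fhom_hom name_arr_hom comp_hom[OF fhom_hom fhom_hom]\<close>)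

text \<open>Names are injective, so the element-wise laws descend to arrows. These two are exactly
  the algebra laws of \<open>free_alg\<close>.\<close>

lemma monad_laws:
  assumes A: "A \<in> Obj V"
  shows "mmult T A \<cdot> munit T (fobj T A) = Id V (fobj T A)"
    and "mmult T A \<cdot> mmult T (fobj T A) = mmult T A \<cdot> arr_map V T (mmult T A)"
proof -
  note m = mmult_hom[OF A] and m' = mmult_hom[OF fobj_obj[OF A]] and n = munit_hom[OF fobj_obj[OF A]]
  note Tm = arr_map(1)[OF m]
  have laws: "elcomp V (self V) (fobj T A) (fobj T (fobj T A)) (fobj T A)
      (name_arr V (mmult T A)) (name_arr V (munit T (fobj T A))) = eid (self V) (fobj T A)"
    "elcomp V (self V) (fobj T (fobj T (fobj T A))) (fobj T (fobj T A)) (fobj T A)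
      (name_arr V (mmult T A)) (name_arr V (mmult T (fobj T A))) =
     elcomp V (self V) (fobj T (fobj T (fobj T A))) (fobj T (fobj T A)) (fobj T A)
      (name_arr V (mmult T A)) (fhom T (fobj T (fobj T A)) (fobj T A) \<cdot> name_arr V (mmult T A))"
    using self_monad A by (simp_all add: self_monad_def enriched_monad_def Let_def)
  show "mmult T A \<cdot> munit T (fobj T A) = Id V (fobj T A)"
    by (rule name_arr_inject)
      (use laws(1) A HomD[OF m] HomD[OF n] in \<open>simp_all add: elcomp_name_arr[OF n m] eid_self\<close>)
  show "mmult T A \<cdot> mmult T (fobj T A) = mmult T A \<cdot> arr_map V T (mmult T A)"
    by (rule name_arr_inject)
      (use laws(2) A HomD[OF m] HomD[OF m'] HomD[OF Tm] in
        \<open>simp_all add: elcomp_name_arr[OF m' m] elcomp_name_arr[OF Tm m] arr_map(2)[OF m]\<close>)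
qed

end


section \<open>Linear spaces\<close>

sublocale linear_spaces \<subseteq> LS: smc_category LS
  by (rule LS_smc)

sublocale linear_spaces \<subseteq> L: monad_on_self X L
  using commutative by unfold_locales (simp add: commutative_monad_def)

section \<open>The category of algebras and its forgetful functor\<close>

context linear_spaces
begin

lemma LS_simps:
  shows "Obj LS = algebras X L" "Arr LS = Arr (EM X L)" "Dom LS = src" "Cod LS = tgt"
    "Id LS = (\<lambda>A. Lin A (Id X (carrier A)) A)"
    "Comp LS = (\<lambda>g f. Lin (src f) (lmap g \<cdot> lmap f) (tgt g))"
proof -
  have "Obj (category.truncate LS) = algebras X L" "Arr (category.truncate LS) = Arr (EM X L)"
    "Dom (category.truncate LS) = src" "Cod (category.truncate LS) = tgt"
    "Id (category.truncate LS) = (\<lambda>A. Lin A (Id X (carrier A)) A)"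
    "Comp (category.truncate LS) = (\<lambda>g f. Lin (src f) (lmap g \<cdot> lmap f) (tgt g))"
    by (simp_all add: LS_cat EM_def)
  then show "Obj LS = algebras X L" "Arr LS = Arr (EM X L)" "Dom LS = src" "Cod LS = tgt"
    "Id LS = (\<lambda>A. Lin A (Id X (carrier A)) A)"
    "Comp LS = (\<lambda>g f. Lin (src f) (lmap g \<cdot> lmap f) (tgt g))"
    by (simp_all add: category.truncate_def)
qed

lemma LS_algebra:
  assumes "A \<in> Obj LS"
  shows "carrier A \<in> Obj X" "struc A \<in> Hom X (fobj L (carrier A)) (carrier A)"
    "struc A \<cdot> munit L (carrier A) = Id X (carrier A)"
    "struc A \<cdot> mmult L (carrier A) = struc A \<cdot> arr_map X L (struc A)"
  using assms by (auto simp: LS_simps algebras_def)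

lemma LS_arr:
  assumes "f \<in> Hom LS A B"
  shows "lmap f \<in> Hom X (carrier A) (carrier B)"
    "lmap f \<cdot> struc A = struc B \<cdot> arr_map X L (lmap f)"
  using assms by (auto simp: LS.mem_Hom_iff LS_simps EM_def)

lemma LS_arrI:
  assumes "A \<in> Obj LS" "B \<in> Obj LS" "f \<in> Hom X (carrier A) (carrier B)"
    "f \<cdot> struc A = struc B \<cdot> arr_map X L f"
  shows "Lin A f B \<in> Hom LS A B"
  using assms by (simp add: LS.mem_Hom_iff LS_simps EM_def)

lemma lmap_comp: "lmap (g \<cdot>\<^bsub>LS\<^esub> f) = lmap g \<cdot> lmap f"
  by (simp add: LS_simps)

lemma lmap_id: "lmap (Id LS A) = Id X (carrier A)"
  by (simp add: LS_simps)

lemma free_alg_obj: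
  assumes A: "A \<in> Obj X"
  shows "free_alg L A \<in> Obj LS"
  using A by (simp add: LS_simps algebras_def free_alg_def L.mmult_hom L.monad_laws)

text \<open>The forgetful functor is represented by free algebras, so it preserves monomorphisms.\<close>

lemma monic_lmap:
  assumes m: "monic LS m"
  shows "monic X (lmap m)"
proof -
  let ?D = "Dom LS m" and ?D' = "Cod LS m"
  have m_arr: "m \<in> Hom LS ?D ?D'"
    using m by (simp add: monic_def LS.mem_Hom_iff)
  note D = LS.HomD(4)[OF m_arr] and D' = LS.HomD(5)[OF m_arr]
  note lm = LS_arr[OF m_arr]
  have *: "f = g"
    if f: "f \<in> Hom X A (carrier ?D)" and g: "g \<in> Hom X A (carrier ?D)"
      and eq: "lmap m \<cdot> f = lmap m \<cdot> g" for A f g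
  proof -
    \<comment> \<open>The linear extension of \<open>k\<close> to the free algebra on
      \<open>A\<close>. Its composite with \<open>m\<close> depends only on
      \<open>lmap m \<cdot> k\<close>, and restriction along the unit recovers \<open>k\<close>, so
      monicity of \<open>m\<close> in \<open>LS\<close> transfers to \<open>lmap m\<close>.\<close>
    define ext where "ext k = Lin (free_alg L A) (struc ?D \<cdot> arr_map X L k) ?D" for k
    note A = HomD(4)[OF f]
    note s = LS_algebra(2)[OF D]
    have ext: "ext k \<in> Hom LS (free_alg L A) ?D"
      and m_ext: "m \<cdot>\<^bsub>LS\<^esub> ext k = Lin (free_alg L A) (struc ?D' \<cdot> arr_map X L (lmap m \<cdot> k)) ?D'"
      and ext_unit: "lmap (ext k) \<cdot> munit L A = k"
      if k: "k \<in> Hom X A (carrier ?D)" for k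
    proof -
      note Lk = L.arr_map(1)[OF k] and LLk = L.arr_map(1)[OF L.arr_map(1)[OF k]]
      note simps = HomD[OF k] HomD[OF Lk] HomD[OF LLk] HomD[OF s] HomD[OF L.arr_map(1)[OF s]]
        HomD[OF L.mmult_hom[OF A]] HomD[OF L.munit_hom[OF A]] HomD[OF L.mmult_hom[of "carrier ?D"]]
        HomD[OF L.munit_hom[of "carrier ?D"]] HomD[OF lm(1)] HomD[OF L.arr_map(1)[OF lm(1)]]
      have "(struc ?D \<cdot> arr_map X L k) \<cdot> mmult L A = struc ?D \<cdot> mmult L (carrier ?D) \<cdot> arr_map X L (arr_map X L k)"
        using simps by (simp add: L.mmult_natural[OF k])
      also have "\<dots> = struc ?D \<cdot> arr_map X L (struc ?D) \<cdot> arr_map X L (arr_map X L k)"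
        using simps comp_cong_tail[OF LS_algebra(4)[OF D], of "arr_map X L (arr_map X L k)"] by simp
      also have "\<dots> = struc ?D \<cdot> arr_map X L (struc ?D \<cdot> arr_map X L k)"
        by (simp add: L.arr_map_comp[OF Lk s])
      finally show "ext k \<in> Hom LS (free_alg L A) ?D"
        unfolding ext_def using D A comp_hom[OF s Lk]
        by (intro LS_arrI free_alg_obj) (simp_all add: free_alg_def)
      have "lmap m \<cdot> struc ?D \<cdot> arr_map X L k = struc ?D' \<cdot> arr_map X L (lmap m) \<cdot> arr_map X L k"
        using simps comp_cong_tail[OF lm(2), of "arr_map X L k"] HomD[OF LS_algebra(2)[OF D']] by simp
      then show "m \<cdot>\<^bsub>LS\<^esub> ext k = Lin (free_alg L A) (struc ?D' \<cdot> arr_map X L (lmap m \<cdot> k)) ?D'"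
        by (simp add: ext_def LS_simps L.arr_map_comp[OF k lm(1)])
      have "(struc ?D \<cdot> arr_map X L k) \<cdot> munit L A = struc ?D \<cdot> munit L (carrier ?D) \<cdot> k"
        using simps by (simp add: L.munit_natural[OF k])
      also have "\<dots> = k"
        using simps comp_cong_tail[OF LS_algebra(3)[OF D], of k] by simp
      finally show "lmap (ext k) \<cdot> munit L A = k"
        by (simp add: ext_def)
    qed
    have "m \<cdot>\<^bsub>LS\<^esub> ext f = m \<cdot>\<^bsub>LS\<^esub> ext g"
      by (simp add: m_ext f g eq)
    then have "ext f = ext g"
      using m ext[OF f] ext[OF g] by (auto simp: monic_def)
    then show "f = g"
      using ext_unit[OF f] ext_unit[OF g] by metis
  qed
  show ?thesis
    unfolding monic_def using * HomD(1-3)[OF lm(1)] by auto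
qed

section \<open>Hom-objects of algebras and names of linear maps\<close>

lemma i_hom:
  assumes A: "A \<in> Obj LS" and B: "B \<in> Obj LS"
  shows "i A B \<in> Hom X (h A B) (ihom X (carrier A) (carrier B))"
  using em_hom[of A B] precomp(1)[OF LS_algebra(2)[OF A] LS_algebra(1)[OF B]] A B
  by (simp add: LS_simps is_equalizer_def em_pair1_def mem_Hom_iff)

lemma bilin_hom: "\<lbrakk>A \<in> Obj LS; B \<in> Obj LS\<rbrakk>
    \<Longrightarrow> bilin X L q A B \<in> Hom X (carrier A \<boxtimes> carrier B) (carrier (A \<boxtimes>\<^bsub>LS\<^esub> B))"
  using LS_forget by (simp add: lax_symmetric_monoidal_def)

lemma unit_constraint_hom: "munit L (unt X) \<in> Hom X (unt X) (carrier (unt LS))"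
  using LS_forget by (simp add: lax_symmetric_monoidal_def)

lemma bilin_natural: "\<lbrakk>f \<in> Arr LS; g \<in> Arr LS\<rbrakk> \<Longrightarrow>
    bilin X L q (Cod LS f) (Cod LS g) \<cdot> (lmap f \<odot> lmap g) =
    lmap (f \<odot>\<^bsub>LS\<^esub> g) \<cdot> bilin X L q (Dom LS f) (Dom LS g)"
  using LS_forget by (simp add: lax_symmetric_monoidal_def)

lemma lmap_lun: "A \<in> Obj LS \<Longrightarrow>
    lmap (lun LS A) \<cdot> bilin X L q (unt LS) A \<cdot> (munit L (unt X) \<odot> Id X (carrier A)) = lun X (carrier A)"
  using LS_forget by (simp add: lax_symmetric_monoidal_def)

text \<open>Reconciles two ways of viewing a linear map as an element: its name in
  \<open>LS\<close>, transported along the forgetful functor and included by \<open>i\<close>, is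
  the name of its underlying map. After evaluation, \<open>LS_ev\<close> passes to evaluation in
  \<open>LS\<close>, naturality of the universal bilinear maps carries the name across, and the left
  unit axiom of the monoidal forgetful functor leaves only \<open>lun\<close>.\<close>

lemma i_name_arr:
  assumes f: "f \<in> Hom LS A B"
  shows "i A B \<cdot> lmap (name_arr LS f) \<cdot> munit L (unt X) = name_arr X (lmap f)"
proof (rule name_arr_eqI)
  note A = LS.HomD(4)[OF f] and B = LS.HomD(5)[OF f]
  let ?u = "munit L (unt X)" and ?n = "name_arr LS f" and ?H = "ihom LS A B"
  let ?a = "carrier A" and ?b = "carrier B"
  note n = LS.name_arr_hom[OF f]
  have ln: "lmap ?n \<in> Hom X (carrier (unt LS)) (h A B)"
    using LS_arr(1)[OF n] A B by (simp add: LS_ihom LS_simps)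
  have ev: "ev LS A B \<in> Hom LS (ihom LS A B \<boxtimes>\<^bsub>LS\<^esub> A) B"
    using A B by (rule LS.ev_hom)
  have nA: "?n \<odot>\<^bsub>LS\<^esub> Id LS A \<in> Hom LS (unt LS \<boxtimes>\<^bsub>LS\<^esub> A) (ihom LS A B \<boxtimes>\<^bsub>LS\<^esub> A)"
    using n LS.id_hom[OF A] by (rule LS.tensa_hom)
  have ev_n: "ev LS A B \<cdot>\<^bsub>LS\<^esub> (?n \<odot>\<^bsub>LS\<^esub> Id LS A) = f \<cdot>\<^bsub>LS\<^esub> lun LS A"
    using LS.name_arr(4)[of f] LS.HomD[OF f] by simp
  have H_carrier: "carrier ?H = h A B"
    using A B by (simp add: LS_ihom LS_simps)
  note simps = HomD[OF ln] HomD[OF LS_arr(1)[OF ev]] HomD[OF LS_arr(1)[OF nA]] HomD[OF i_hom[OF A B]]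
    HomD[OF unit_constraint_hom] HomD[OF LS_arr(1)[OF f]] LS_algebra(1)[OF A] LS_algebra(1)[OF B]
    HomD[OF bilin_hom[OF LS.unt_obj A]] HomD[OF LS_arr(1)[OF LS.lun_hom[OF A]]]
    HomD[OF bilin_hom[OF LS.ihom_obj[OF A B] A], unfolded H_carrier]
  \<comment> \<open>The only link assumed between evaluation in \<open>LS\<close> and evaluation in
    \<open>X\<close>.\<close>
  have ev_i: "ev X ?a ?b \<cdot> (i A B \<odot> Id X ?a) = lmap (ev LS A B) \<cdot> bilin X L q ?H A"
    using LS_ev[of A B] A B by (simp add: LS_simps uncurry_arr_def)
  have nat: "bilin X L q ?H A \<cdot> (lmap ?n \<odot> Id X ?a) =
      lmap (?n \<odot>\<^bsub>LS\<^esub> Id LS A) \<cdot> bilin X L q (unt LS) A"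
    using bilin_natural[of ?n "Id LS A"] LS.HomD[OF n] A by (simp add: lmap_id)
  have "ev X ?a ?b \<cdot> ((i A B \<cdot> lmap ?n \<cdot> ?u) \<odot> Id X ?a) =
      (lmap (ev LS A B) \<cdot> bilin X L q ?H A) \<cdot> ((lmap ?n \<cdot> ?u) \<odot> Id X ?a)"
    using simps by (intro ev_comp_left ev_i) simp_all
  also have "\<dots> = lmap (ev LS A B) \<cdot> bilin X L q ?H A \<cdot> (lmap ?n \<odot> Id X ?a) \<cdot> (?u \<odot> Id X ?a)"
    using simps by (simp add: interchange)
  also have "\<dots> = (lmap (ev LS A B) \<cdot> lmap (?n \<odot>\<^bsub>LS\<^esub> Id LS A)) \<cdot> bilin X L q (unt LS) A \<cdot> (?u \<odot> Id X ?a)"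
    using simps comp_cong_tail[OF nat, of "?u \<odot> Id X ?a"] by simp
  also have "\<dots> = (lmap f \<cdot> lmap (lun LS A)) \<cdot> bilin X L q (unt LS) A \<cdot> (?u \<odot> Id X ?a)"
    by (simp only: ev_n flip: lmap_comp)
  also have "\<dots> = lmap f \<cdot> lun X ?a"
    using simps by (simp add: lmap_lun A)
  finally show "ev X ?a ?b \<cdot> ((i A B \<cdot> lmap ?n \<cdot> ?u) \<odot> Id X ?a) = lmap f \<cdot> lun X ?a" .
  show "i A B \<cdot> lmap ?n \<cdot> ?u \<in> Hom X (unt X) (ihom X ?a ?b)"
    using simps by (simp add: mem_Hom_iff)
qed (fact LS_arr(1)[OF f])

abbreviation H :: "(('o, 'a) alg, ('o, 'a) lin) emonad" where
  "H \<equiv> lin_dd LS"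

lemma H_hom:
  assumes E: "E \<in> Obj LS"
  shows "munit H E \<in> Hom LS E (fobj H E)"
    and "mmult H E \<in> Hom LS (fobj H (fobj H E)) (fobj H E)"
    and "fobj H E \<in> Obj LS"
  using LS.dd_unit(1)[OF LS.unt_obj E] LS.dd_mmult_hom[OF LS.unt_obj E] LS.HomD(5)
  by (auto simp: lin_dd_def dd_monad_def)

end

section \<open>Pettis structures\<close>

sublocale abstract_distribution_monad \<subseteq> M: monad_on_self X M
  using M_monad by unfold_locales

section \<open>The axioms on \<open>\<xi>\<close>, read as equations between maps of
  \<open>X\<close>\<close>

context abstract_distribution_monad
begin

text \<open>The unit axiom of the morphism \<open>\<xi>\<close> is an equation of elements of a
  hom-object of \<open>X\<close>. Its right side is the transported name of a linear map, which
  \<open>i_name_arr\<close> converts into the name of the underlying map.\<close>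

lemma xi_unit:
  assumes E: "E \<in> Obj LS"
  shows "\<xi> E \<cdot> munit M (carrier E) = lmap (munit H E)"
proof -
  note c = LS_algebra(1)[OF E]
  have xi: "\<xi> E \<in> Hom X (fobj M (carrier E)) (carrier (fobj H E))"
    using E by (intro xi_hom) (simp add: LS_simps)
  note n = M.munit_hom[OF c] and d = H_hom(1)[OF E]
  have "elcomp X (self X) (carrier E) (fobj M (carrier E)) (carrier (fobj H E))
      (name_arr X (\<xi> E)) (name_arr X (munit M (carrier E))) =
      i E (fobj H E) \<cdot> lmap (name_arr LS (munit H E)) \<cdot> munit L (unt X)"
    using xi_morphism E
    by (simp add: monad_morphism_def Let_def em_ecategory_def em_forget_def lin_dd_enriched_def
        base_change_def LS_simps)
  then have "name_arr X (\<xi> E \<cdot> munit M (carrier E)) = name_arr X (lmap (munit H E))"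
    by (simp only: elcomp_name_arr[OF n xi] i_name_arr[OF d])
  then show ?thesis
    by (rule name_arr_inject) (use HomD[OF xi] HomD[OF n] HomD[OF LS_arr(1)[OF d]] in simp_all)
qed

lemma xi_mult:
  assumes E: "E \<in> Obj LS"
  shows "\<xi> E \<cdot> mmult M (carrier E) =
    lmap (mmult H E) \<cdot> \<xi> (fobj H E) \<cdot> arr_map X M (\<xi> E)"
proof -
  note c = LS_algebra(1)[OF E]
  note HE = H_hom(3)[OF E]
  have xi: "\<xi> A \<in> Hom X (fobj M (carrier A)) (carrier (fobj H A))" if "A \<in> Obj LS" for A
    using that by (intro xi_hom) (simp add: LS_simps)
  note m = M.mmult_hom[OF c] and k = H_hom(2)[OF E] and Mxi = M.arr_map(1)[OF xi[OF E]]
  note xx = comp_hom[OF xi[OF HE] Mxi]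
  note lk = LS_arr(1)[OF k]
  have "elcomp X (self X) (fobj M (fobj M (carrier E))) (fobj M (carrier E)) (carrier (fobj H E))
      (name_arr X (\<xi> E)) (name_arr X (mmult M (carrier E))) =
      elcomp X (self X) (fobj M (fobj M (carrier E))) (carrier (fobj H (fobj H E))) (carrier (fobj H E))
       (i (fobj H (fobj H E)) (fobj H E) \<cdot> lmap (name_arr LS (mmult H E)) \<cdot> munit L (unt X))
       (elcomp X (self X) (fobj M (fobj M (carrier E))) (fobj M (carrier (fobj H E)))
         (carrier (fobj H (fobj H E))) (name_arr X (\<xi> (fobj H E)))
         (fhom M (fobj M (carrier E)) (carrier (fobj H E)) \<cdot> name_arr X (\<xi> E)))"
    using xi_morphism E
    by (simp add: monad_morphism_def Let_def em_ecategory_def em_forget_def lin_dd_enriched_def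
        base_change_def LS_simps)
  then have "name_arr X (\<xi> E \<cdot> mmult M (carrier E)) =
      name_arr X (lmap (mmult H E) \<cdot> \<xi> (fobj H E) \<cdot> arr_map X M (\<xi> E))"
    by (simp only: elcomp_name_arr[OF m xi[OF E]] i_name_arr[OF k] M.arr_map(2)[OF xi[OF E]]
        elcomp_name_arr[OF Mxi xi[OF HE]] elcomp_name_arr[OF xx lk])
  then show ?thesis
    by (rule name_arr_inject) (use HomD[OF xi[OF E]] HomD[OF m] HomD[OF lk] HomD[OF xx] in simp_all)
qed

text \<open>The double dual of \<open>f\<close> is written as two precompositions, the form in which
  \<open>dd_mmult_unit\<close> can later cancel it against the multiplication.\<close>

lemma xi_natural:
  assumes f: "f \<in> Hom LS A B"
  shows "\<xi> B \<cdot> arr_map X M (lmap f) =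
    lmap (precomp LS (precomp LS f (unt LS)) (unt LS)) \<cdot> \<xi> A"
proof -
  note A = LS.HomD(4)[OF f] and B = LS.HomD(5)[OF f]
  note HA = H_hom(3)[OF A] and HB = H_hom(3)[OF B]
  let ?Hf = "precomp LS (precomp LS f (unt LS)) (unt LS)"
  let ?u = "munit L (unt X)"
  let ?F = "comp_functor X (elements X M) (em_forget i)"
  let ?G = "comp_functor X (em_forget i) (lin_dd_enriched X L LS)"
  have xi: "\<xi> A \<in> Hom X (fobj M (carrier A)) (carrier (fobj H A))" if "A \<in> Obj LS" for A
    using that by (intro xi_hom) (simp add: LS_simps)
  have Hf: "?Hf \<in> Hom LS (fobj H A) (fobj H B)"
    using LS.precomp(1)[OF LS.precomp(1)[OF f LS.unt_obj] LS.unt_obj] by (simp add: lin_dd_def dd_monad_def)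
  have H_fhom: "fhom H A B \<in> Hom LS (ihom LS A B) (ihom LS (fobj H A) (fobj H B))"
    unfolding lin_dd_def by (rule LS.dd_fhom_hom[OF LS.unt_obj A B])
  have carriers: "carrier (ihom LS A B) = h A B" "carrier (ihom LS (fobj H A) (fobj H B)) = h (fobj H A) (fobj H B)"
    using A B HA HB by (simp_all add: LS_ihom LS_simps)
  note n = LS.name_arr_hom[OF f]
  note iA = i_hom[OF A B] and iH = i_hom[OF HA HB]
  note ln = LS_arr(1)[OF n, unfolded carriers] and lH = LS_arr(1)[OF H_fhom, unfolded carriers]
  note u = unit_constraint_hom
  note simps = HomD[OF ln] HomD[OF lH] HomD[OF iA] HomD[OF iH] HomD[OF u]
  have fobj: "fobj ?F C = fobj M (carrier C)" "fobj ?G C = carrier (fobj H C)" for C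
    by (simp_all add: em_forget_def lin_dd_enriched_def base_change_def)
  have fhom: "fhom ?F A B = fhom M (carrier A) (carrier B) \<cdot> i A B"
    "fhom ?G A B = i (fobj H A) (fobj H B) \<cdot> lmap (fhom H A B)"
    by (simp_all add: em_forget_def lin_dd_enriched_def base_change_def)
  have ehom: "ehom (em_ecategory X L h i) A B = h A B"
    by (simp add: em_ecategory_def)
  note M_hom = M.fhom_hom[OF LS_algebra(1)[OF A] LS_algebra(1)[OF B]]
  show ?thesis
  \<comment> \<open>The element \<open>e\<close> is the name of \<open>f\<close> in
    \<open>LS\<close>, transported to the hom-object \<open>h A B\<close> along the unit constraint
    of the forgetful functor.\<close>
  proof (rule enriched_natural_imp_natural[where B = "em_ecategory X L h i" and F = ?F and G = ?G
        and \<tau> = \<xi> and a = A and b = B and e = "lmap (name_arr LS f) \<cdot> ?u"])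
    show "enriched_natural X (em_ecategory X L h i) (self X) ?F ?G (\<lambda>E. name_arr X (\<xi> E))"
      using xi_morphism by (simp add: monad_morphism_def)
    show "A \<in> eobj (em_ecategory X L h i)" "B \<in> eobj (em_ecategory X L h i)"
      using A B by (simp_all add: em_ecategory_def LS_simps)
    show "\<xi> A \<in> Hom X (fobj ?F A) (fobj ?G A)" "\<xi> B \<in> Hom X (fobj ?F B) (fobj ?G B)"
      unfolding fobj using xi A B by simp_all
    show "fhom ?F A B \<in> Hom X (ehom (em_ecategory X L h i) A B) (ihom X (fobj ?F A) (fobj ?F B))"
      unfolding fobj fhom ehom by (rule comp_hom[OF M_hom iA])
    show "fhom ?G A B \<in> Hom X (ehom (em_ecategory X L h i) A B) (ihom X (fobj ?G A) (fobj ?G B))"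
      unfolding fobj fhom ehom by (rule comp_hom[OF iH lH])
    show "lmap (name_arr LS f) \<cdot> ?u \<in> Hom X (unt X) (ehom (em_ecategory X L h i) A B)"
      unfolding ehom by (rule comp_hom[OF ln u])
    have "(fhom M (carrier A) (carrier B) \<cdot> i A B) \<cdot> lmap (name_arr LS f) \<cdot> ?u =
        fhom M (carrier A) (carrier B) \<cdot> i A B \<cdot> lmap (name_arr LS f) \<cdot> ?u"
      using simps HomD[OF M_hom] by simp
    then show "fhom ?F A B \<cdot> lmap (name_arr LS f) \<cdot> ?u = name_arr X (arr_map X M (lmap f))"
      unfolding fhom by (simp only: i_name_arr[OF f] M.arr_map(2)[OF LS_arr(1)[OF f]])
    have "(i (fobj H A) (fobj H B) \<cdot> lmap (fhom H A B)) \<cdot> lmap (name_arr LS f) \<cdot> ?u =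
        i (fobj H A) (fobj H B) \<cdot> (lmap (fhom H A B) \<cdot> lmap (name_arr LS f)) \<cdot> ?u"
      using simps by simp
    \<comment> \<open>The hom-action of \<open>H\<close> is computed inside \<open>LS\<close>,
      before the forgetful functor is applied; this is possible because \<open>lmap\<close>
      preserves composition.\<close>
    also have "\<dots> = i (fobj H A) (fobj H B) \<cdot> lmap (name_arr LS ?Hf) \<cdot> ?u"
      using LS.dd_fhom_name_arr[OF LS.unt_obj f] by (simp only: lin_dd_def flip: lmap_comp)
    also have "\<dots> = name_arr X (lmap ?Hf)"
      by (rule i_name_arr[OF Hf])
    finally show "fhom ?G A B \<cdot> lmap (name_arr LS f) \<cdot> ?u = name_arr X (lmap ?Hf)"
      unfolding fhom .
    show "arr_map X M (lmap f) \<in> Hom X (fobj ?F A) (fobj ?F B)"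
      unfolding fobj by (rule M.arr_map(1)[OF LS_arr(1)[OF f]])
    show "lmap ?Hf \<in> Hom X (fobj ?G A) (fobj ?G B)"
      unfolding fobj by (rule LS_arr(1)[OF Hf])
  qed
qed

section \<open>Verification of the two algebra laws\<close>

lemma Pettis_algebra:
  assumes "Pettis X LS M \<xi> E"
  shows "Alg (carrier E) (Pettis_structure X LS M \<xi> E) \<in> algebras X M"
proof -
  define a where "a = Pettis_structure X LS M \<xi> E"
  have E: "E \<in> Obj LS"
    using assms by (simp add: Pettis_def)
  let ?c = "carrier E" and ?d = "lmap (munit H E)"
  note c = LS_algebra(1)[OF E]
  note d = LS_arr(1)[OF H_hom(1)[OF E]]
  \<comment> \<open>Separatedness enters here: an embedding in \<open>LS\<close> is monic, and its
    underlying map stays monic in \<open>X\<close>. The resulting \<open>cancel\<close> also gives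
    uniqueness of the Pettis structure, which the definite description requires.\<close>
  have "monic X ?d"
    using assms by (intro monic_lmap) (simp add: Pettis_def separated_def strong_mono_def)
  then have cancel: "f = g" if "?d \<cdot> f = ?d \<cdot> g" "f \<in> Hom X A ?c" "g \<in> Hom X A ?c" for f g A
    using that HomD[OF d] by (auto simp: monic_def)
  have "\<exists>!a. is_Pettis_structure X LS M \<xi> E a"
    using assms cancel by (auto simp: Pettis_def is_Pettis_structure_def)
  then have "is_Pettis_structure X LS M \<xi> E a"
    unfolding a_def Pettis_structure_def by (rule theI')
  then have a: "a \<in> Hom X (fobj M ?c) ?c" and da: "?d \<cdot> a = \<xi> E"
    by (simp_all add: is_Pettis_structure_def)
  have xi: "\<xi> A \<in> Hom X (fobj M (carrier A)) (carrier (fobj H A))" if "A \<in> Obj LS" for A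
    using that by (intro xi_hom) (simp add: LS_simps)
  note n = M.munit_hom[OF c] and m = M.mmult_hom[OF c]
  note Ma = M.arr_map(1)[OF a] and Md = M.arr_map(1)[OF d]
  let ?Hd = "precomp LS (precomp LS (munit H E) (unt LS)) (unt LS)"
  have Hd: "?Hd \<in> Hom LS (fobj H E) (fobj H (fobj H E))"
    using LS.precomp(1)[OF LS.precomp(1)[OF H_hom(1)[OF E] LS.unt_obj] LS.unt_obj]
    by (simp add: lin_dd_def dd_monad_def)
  note k = LS_arr(1)[OF H_hom(2)[OF E]]
  note simps = HomD[OF a] HomD[OF d] HomD[OF n] HomD[OF m] HomD[OF Ma] HomD[OF Md] HomD[OF xi[OF E]]
    HomD[OF xi[OF H_hom(3)[OF E]]] HomD[OF LS_arr(1)[OF Hd]] HomD[OF k]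
  have unit: "a \<cdot> munit M ?c = Id X ?c"
  proof (rule cancel)
    show "?d \<cdot> a \<cdot> munit M ?c = ?d \<cdot> Id X ?c"
      using simps c comp_cong_tail[OF da, of "munit M ?c"] by (simp add: xi_unit[OF E])
  qed (use comp_hom[OF a n] id_hom[OF c] in simp_all)
  have mult: "a \<cdot> mmult M ?c = a \<cdot> arr_map X M a"
  proof (rule cancel)
    have "lmap (mmult H E) \<cdot> lmap ?Hd = Id X (carrier (fobj H E))"
      using LS.dd_mmult_unit[OF LS.unt_obj E] by (simp add: lin_dd_def lmap_id flip: lmap_comp)
    \<comment> \<open>The monad law k \<cdot> Hd = 1 with a tail, ready for use at the head of a
      longer composite.\<close>
    then have k_Hd: "lmap (mmult H E) \<cdot> lmap ?Hd \<cdot> x = x"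
      if "x \<in> Arr X" "Cod X x = carrier (fobj H E)" for x
      using simps that comp_cong_tail[of "lmap (mmult H E)" "lmap ?Hd" _ x] by simp
    have "?d \<cdot> a \<cdot> mmult M ?c = \<xi> E \<cdot> mmult M ?c"
      using simps comp_cong_tail[OF da, of "mmult M ?c"] by simp
    \<comment> \<open>The factor \<open>arr_map X M (\<xi> E)\<close> supplied by
      \<open>xi_mult\<close> splits because \<open>\<xi> E\<close> is \<open>?d \<cdot> a\<close>.
      This exposes \<open>arr_map X M ?d\<close>, to which naturality of \<open>\<xi>\<close> at the
      linear map d applies.\<close>
    also have "\<dots> = lmap (mmult H E) \<cdot> \<xi> (fobj H E) \<cdot> arr_map X M ?d \<cdot> arr_map X M a"
      using M.arr_map_comp[OF a d] by (simp add: xi_mult[OF E] da)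
    also have "\<dots> = lmap (mmult H E) \<cdot> lmap ?Hd \<cdot> \<xi> E \<cdot> arr_map X M a"
      using simps comp_cong_tail[OF xi_natural[OF H_hom(1)[OF E]], of "arr_map X M a"] by simp
    also have "\<dots> = \<xi> E \<cdot> arr_map X M a"
      using simps by (simp add: k_Hd)
    also have "\<dots> = ?d \<cdot> a \<cdot> arr_map X M a"
      using simps comp_cong_tail[OF da, of "arr_map X M a"] by simp
    finally show "?d \<cdot> a \<cdot> mmult M ?c = ?d \<cdot> a \<cdot> arr_map X M a" .
  qed (rule comp_hom[OF a m] comp_hom[OF a Ma])+
  show ?thesis
    using c a unit mult by (simp add: algebras_def a_def)
qed

end

theorem theorem8p8p3:
  fixes X :: "('o, 'a) smc_category"
    and LS :: "(('o, 'a) alg, ('o, 'a) lin) smc_category"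
    and L M :: "('o, 'a) emonad"
    and h :: "('o, 'a) alg \<Rightarrow> ('o, 'a) alg \<Rightarrow> 'o"
    and i :: "('o, 'a) alg \<Rightarrow> ('o, 'a) alg \<Rightarrow> 'a"
    and q :: "('o, 'a) alg \<Rightarrow> ('o, 'a) alg \<Rightarrow> ('o, 'a) lin"
    and \<Delta> :: "'o \<Rightarrow> 'a"
    and \<xi> :: "('o, 'a) alg \<Rightarrow> 'a"
    and E :: "('o, 'a) alg"
  assumes "abstract_distribution_monad X L h i q LS M \<Delta> \<xi>"
    and "Pettis X LS M \<xi> E"
  shows "Alg (carrier E) (Pettis_structure X LS M \<xi> E) \<in> algebras X M"
  using assms by (rule abstract_distribution_monad.Pettis_algebra)

end
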